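(* Let $X$ be a compact metric space with its Borel $\sigma$-algebra, $r:X\to X$ a measurable onto map with $\#r^{-1}(x)<\infty$ for all $x$, $\mu$ a strongly $r$-invariant probability measure on $X$, $m_0\in L^\infty(X)$, and $h\in L^1(X)$ with $h\ge 0$ and $Rh=h$. Let $$\mathcal{H}=\Big\{(\xi_0,\xi_1,\dots) : \xi_n\in L^2(X,\omega_n),\ R(\xi_{n+1}h)=\xi_nh\ (n\ge0),\ \sup_n\int_XR^n(|\xi_n|^2h)\,\mathrm{d}\mu<\infty\Big\}$$ with the scalar product $$\langle(\xi_0,\xi_1,\dots)\mid(\eta_0,\eta_1,\dots)\rangle=\lim_{n\to\infty}\int_XR^n(\overline{\xi_n}\eta_nh)\,\mathrm{d}\mu .$$ Then the map $\Phi:L^2(X_\infty,\hat\mu)\to\mathcal{H}$ defined by $$\Phi(f)=(i_n^{-1}(P_nf))_{n\ge0},$$ where $P_n$ is the orthogonal projection onto $H_n$, is an isomorphism (of Hilbert spaces), and $$\Phi U\Phi^{-1}(\xi_n)_{n\ge0}=(m_0\circ r^n\;\xi_{n+1})_{n\ge0},$$ $$\Phi\pi(g)\Phi^{-1}(\xi_n)_{n\ge0}=(g\circ r^n\;\xi_n)_{n\ge0}\quad(g\in L^\infty(X)),$$ $$\Phi\varphi=(1,1,\dots).$$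
   Context: Strong $r$-invariance of $\mu$: $\int_X f\,\mathrm{d}\mu=\int_X\frac{1}{\#r^{-1}(x)}\sum_{r(y)=x}f(y)\,\mathrm{d}\mu(x)$ for all $f\in L^\infty(X)=L^\infty(X,\mu)$. The operator $R$ is $(R\xi)(x)=\frac{1}{\#r^{-1}(x)}\sum_{r(y)=x}|m_0(y)|^2\xi(y)$. The measures $\omega_n$ on $X$ are given by $\int_Xf\,\mathrm{d}\omega_n=\int_XR^n(fh)\,\mathrm{d}\mu$. $X_\infty=\{\hat x=(x_0,x_1,\dots) : x_n\in X,\ r(x_{n+1})=x_n \text{ for all } n\ge 0\}$, $\theta_n(\hat x)=x_n$, with the $\sigma$-algebra generated by the maps $\theta_n$; $\hat r(\hat x)=(r(x_0),x_0,x_1,\dots)$, a bijection of $X_\infty$. The measure $\hat\mu$ is the unique measure on $X_\infty$ with $\hat\mu\circ\theta_n^{-1}=\omega_n$ for all $n\ge0$. Functions on $X$ are regarded as functions on $X_\infty$ via $g\mapsto g\circ\theta_0$. On $L^2(X_\infty,\hat\mu)$: $Uf=m_0\,f\circ\hat r$ (an isometry), $\pi(g)f=gf$ for $g\in L^\infty(X)$, $\varphi=1$. $H_n=\{\xi\circ\theta_n : \xi\in L^2(X,\omega_n)\}\subset L^2(X_\infty,\hat\mu)$, an increasing sequence of closed subspaces with dense union, and $i_n:L^2(X,\omega_n)\to H_n$, $i_n(\xi)=\xi\circ\theta_n$, is an isometric isomorphism. The elements $\xi_n$ are classes modulo $\omega_n$-null sets, and the identity $R(\xi_{n+1}h)=\xi_nh$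 is understood $\omega_n$-almost everywhere. *)

theory Defs
  imports "HOL-Probability.Probability"
begin

record 'v complex_space =
  vcarrier :: "'v set"
  vadd :: "'v \<Rightarrow> 'v \<Rightarrow> 'v"
  vzero :: "'v"
  vscale :: "complex \<Rightarrow> 'v \<Rightarrow> 'v"
  vinner :: "'v \<Rightarrow> 'v \<Rightarrow> complex"

definition vdiff :: "('v, 'm) complex_space_scheme \<Rightarrow> 'v \<Rightarrow> 'v \<Rightarrow> 'v" where
  "vdiff H u v = vadd H u (vscale H (-1) v)"

definition vnorm :: "('v, 'm) complex_space_scheme \<Rightarrow> 'v \<Rightarrow> real" where
  "vnorm H v = sqrt (Re (vinner H v v))"

text \<open>The scalar product is linear in its second argument.\<close>

locale complex_hilbert_space =
  fixes H :: "('v, 'm) complex_space_scheme" (structure)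
  assumes zero_closed: "vzero H \<in> vcarrier H"
    and add_closed: "\<lbrakk>u \<in> vcarrier H; v \<in> vcarrier H\<rbrakk> \<Longrightarrow> vadd H u v \<in> vcarrier H"
    and scale_closed: "u \<in> vcarrier H \<Longrightarrow> vscale H c u \<in> vcarrier H"
    and add_assoc: "\<lbrakk>u \<in> vcarrier H; v \<in> vcarrier H; w \<in> vcarrier H\<rbrakk>
          \<Longrightarrow> vadd H (vadd H u v) w = vadd H u (vadd H v w)"
    and add_commute: "\<lbrakk>u \<in> vcarrier H; v \<in> vcarrier H\<rbrakk> \<Longrightarrow> vadd H u v = vadd H v u"
    and add_zero: "u \<in> vcarrier H \<Longrightarrow> vadd H u (vzero H) = u"
    and diff_self: "u \<in> vcarrier H \<Longrightarrow> vdiff H u u = vzero H"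
    and scale_add_right: "\<lbrakk>u \<in> vcarrier H; v \<in> vcarrier H\<rbrakk>
          \<Longrightarrow> vscale H c (vadd H u v) = vadd H (vscale H c u) (vscale H c v)"
    and scale_add_left: "u \<in> vcarrier H
          \<Longrightarrow> vscale H (c + d) u = vadd H (vscale H c u) (vscale H d u)"
    and scale_scale: "u \<in> vcarrier H \<Longrightarrow> vscale H c (vscale H d u) = vscale H (c * d) u"
    and scale_one: "u \<in> vcarrier H \<Longrightarrow> vscale H 1 u = u"
    and inner_commute: "\<lbrakk>u \<in> vcarrier H; v \<in> vcarrier H\<rbrakk>
          \<Longrightarrow> vinner H u v = cnj (vinner H v u)"
    and inner_add_right: "\<lbrakk>u \<in> vcarrier H; v \<in> vcarrier H; w \<in> vcarrier H\<rbrakk>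
          \<Longrightarrow> vinner H u (vadd H v w) = vinner H u v + vinner H u w"
    and inner_scale_right: "\<lbrakk>u \<in> vcarrier H; v \<in> vcarrier H\<rbrakk>
          \<Longrightarrow> vinner H u (vscale H c v) = c * vinner H u v"
    and inner_nonneg: "u \<in> vcarrier H \<Longrightarrow> 0 \<le> Re (vinner H u u)"
    and inner_eq_zero: "\<lbrakk>u \<in> vcarrier H; vinner H u u = 0\<rbrakk> \<Longrightarrow> u = vzero H"
    and complete: "\<lbrakk>\<And>n. s n \<in> vcarrier H;
          \<forall>e>0. \<exists>N. \<forall>m\<ge>N. \<forall>n\<ge>N. vnorm H (vdiff H (s m) (s n)) < e\<rbrakk>
          \<Longrightarrow> \<exists>l\<in>vcarrier H. (\<lambda>n. vnorm H (vdiff H (s n) l)) \<longlonglongrightarrow> 0"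

definition hilbert_space_isomorphism ::
    "('v, 'm) complex_space_scheme \<Rightarrow> ('w, 'k) complex_space_scheme \<Rightarrow> ('v \<Rightarrow> 'w) \<Rightarrow> bool" where
  "hilbert_space_isomorphism H K T \<longleftrightarrow>
     complex_hilbert_space H \<and> complex_hilbert_space K \<and>
     bij_betw T (vcarrier H) (vcarrier K) \<and>
     (\<forall>u\<in>vcarrier H. \<forall>v\<in>vcarrier H. T (vadd H u v) = vadd K (T u) (T v)) \<and>
     (\<forall>c. \<forall>u\<in>vcarrier H. T (vscale H c u) = vscale K c (T u)) \<and>
     (\<forall>u\<in>vcarrier H. \<forall>v\<in>vcarrier H. vinner K (T u) (T v) = vinner H u v)"

definition orthogonal_projection ::
    "('v, 'm) complex_space_scheme \<Rightarrow> 'v set \<Rightarrow> 'v \<Rightarrow> 'v" where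
  "orthogonal_projection H S v =
     (THE p. p \<in> S \<and> (\<forall>s\<in>S. vinner H s (vdiff H v p) = 0))"

definition Linf :: "'a measure \<Rightarrow> ('a \<Rightarrow> complex) set" where
  "Linf M = {f \<in> borel_measurable M. \<exists>C. AE x in M. cmod (f x) \<le> C}"

definition square_integrable :: "'a measure \<Rightarrow> ('a \<Rightarrow> complex) set" where
  "square_integrable M = {f \<in> borel_measurable M. integrable M (\<lambda>x. (cmod (f x))\<^sup>2)}"

definition ae_rel :: "'a measure \<Rightarrow> (('a \<Rightarrow> complex) \<times> ('a \<Rightarrow> complex)) set" where
  "ae_rel M = {(f, g). f \<in> square_integrable M \<and> g \<in> square_integrable M \<and>
                       (AE x in M. f x = g x)}"

definition ae_class :: "'a measure \<Rightarrow> ('a \<Rightarrow> complex) \<Rightarrow> ('a \<Rightarrow> complex) set" where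
  "ae_class M f = ae_rel M `` {f}"

text \<open>An arbitrary representative of a class; all constructions below are independent of the
  choice up to null sets.\<close>

definition rep :: "('a \<Rightarrow> complex) set \<Rightarrow> 'a \<Rightarrow> complex" where
  "rep F = (SOME f. f \<in> F)"

definition L2 :: "'a measure \<Rightarrow> ('a \<Rightarrow> complex) set complex_space" where
  "L2 M =
    \<lparr>vcarrier = square_integrable M // ae_rel M,
     vadd = (\<lambda>F G. ae_class M (\<lambda>x. rep F x + rep G x)),
     vzero = ae_class M (\<lambda>x. 0),
     vscale = (\<lambda>c F. ae_class M (\<lambda>x. c * rep F x)),
     vinner = (\<lambda>F G. \<integral>x. cnj (rep F x) * rep G x \<partial>M)\<rparr>"

definition strongly_invariant :: "('a \<Rightarrow> 'a) \<Rightarrow> 'a measure \<Rightarrow> bool" where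
  "strongly_invariant r \<mu> \<longleftrightarrow>
     (\<forall>f\<in>Linf \<mu>. (\<integral>x. f x \<partial>\<mu>) =
        (\<integral>x. 1 / of_nat (card (r -` {x})) * (\<Sum>y\<in>r -` {x}. f y) \<partial>\<mu>))"

text \<open>Polymorphic in the scalars, so that it applies to real and to complex functions.\<close>

definition transfer_op ::
    "('a \<Rightarrow> 'a) \<Rightarrow> ('a \<Rightarrow> complex) \<Rightarrow> ('a \<Rightarrow> 'b::real_normed_field) \<Rightarrow> 'a \<Rightarrow> 'b" where
  "transfer_op r m0 \<xi> x =
     1 / of_nat (card (r -` {x})) * (\<Sum>y\<in>r -` {x}. of_real ((cmod (m0 y))\<^sup>2) * \<xi> y)"

text \<open>\<open>\<omega>\<^sub>n\<close> is given by \<open>\<integral> f d\<omega>\<^sub>n = \<integral> R\<^sup>n (f h) d\<mu>\<close>; taking \<open>f\<close> to be indicator functions determines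
  it. Countable additivity of the set function (without which \<open>measure_of\<close> would return the zero
  measure) holds under strong invariance for almost everywhere nonnegative integrable \<open>h\<close>.\<close>

definition omega ::
    "('a::topological_space \<Rightarrow> 'a) \<Rightarrow> 'a measure \<Rightarrow> ('a \<Rightarrow> complex) \<Rightarrow> ('a \<Rightarrow> real) \<Rightarrow> nat
      \<Rightarrow> 'a measure" where
  "omega r \<mu> m0 h n = measure_of UNIV (sets borel)
     (\<lambda>A. ennreal (\<integral>x. (transfer_op r m0 ^^ n) (\<lambda>y. indicator A y * h y) x \<partial>\<mu>))"

definition Xinf :: "('a \<Rightarrow> 'a) \<Rightarrow> (nat \<Rightarrow> 'a) set" where
  "Xinf r = {x. \<forall>n. r (x (Suc n)) = x n}"

definition theta :: "nat \<Rightarrow> (nat \<Rightarrow> 'a) \<Rightarrow> 'a" where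
  "theta n x = x n"

text \<open>Used only for its \<open>\<sigma>\<close>-algebra, the one generated by the maps \<open>\<theta>\<^sub>n\<close>.\<close>

definition Xinf_space :: "('a::topological_space \<Rightarrow> 'a) \<Rightarrow> (nat \<Rightarrow> 'a) measure" where
  "Xinf_space r = sigma (Xinf r) {theta n -` A \<inter> Xinf r |n A. A \<in> sets borel}"

definition rhat :: "('a \<Rightarrow> 'a) \<Rightarrow> (nat \<Rightarrow> 'a) \<Rightarrow> (nat \<Rightarrow> 'a)" where
  "rhat r x = case_nat (r (x 0)) x"

definition U_op ::
    "('a \<Rightarrow> 'a) \<Rightarrow> ('a \<Rightarrow> complex) \<Rightarrow> (nat \<Rightarrow> 'a) measure
      \<Rightarrow> ((nat \<Rightarrow> 'a) \<Rightarrow> complex) set \<Rightarrow> ((nat \<Rightarrow> 'a) \<Rightarrow> complex) set" where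
  "U_op r m0 M F = ae_class M (\<lambda>x. m0 (theta 0 x) * rep F (rhat r x))"

definition pi_op ::
    "(nat \<Rightarrow> 'a) measure \<Rightarrow> ('a \<Rightarrow> complex)
      \<Rightarrow> ((nat \<Rightarrow> 'a) \<Rightarrow> complex) set \<Rightarrow> ((nat \<Rightarrow> 'a) \<Rightarrow> complex) set" where
  "pi_op M g F = ae_class M (\<lambda>x. g (theta 0 x) * rep F x)"

definition i_map ::
    "(nat \<Rightarrow> 'a) measure \<Rightarrow> nat \<Rightarrow> ('a \<Rightarrow> complex) set \<Rightarrow> ((nat \<Rightarrow> 'a) \<Rightarrow> complex) set" where
  "i_map M n F = ae_class M (\<lambda>x. rep F (theta n x))"

definition H_sub ::
    "(nat \<Rightarrow> 'a measure) \<Rightarrow> (nat \<Rightarrow> 'a) measure \<Rightarrow> nat \<Rightarrow> ((nat \<Rightarrow> 'a) \<Rightarrow> complex) set set" where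
  "H_sub \<omega> M n = i_map M n ` vcarrier (L2 (\<omega> n))"

definition seq_space ::
    "('a::topological_space \<Rightarrow> 'a) \<Rightarrow> 'a measure \<Rightarrow> ('a \<Rightarrow> complex) \<Rightarrow> ('a \<Rightarrow> real)
      \<Rightarrow> (nat \<Rightarrow> ('a \<Rightarrow> complex) set) complex_space" where
  "seq_space r \<mu> m0 h =
    \<lparr>vcarrier = {\<Xi>.
        (\<forall>n. \<Xi> n \<in> vcarrier (L2 (omega r \<mu> m0 h n))) \<and>
        (\<forall>n. AE x in omega r \<mu> m0 h n.
           transfer_op r m0 (\<lambda>y. rep (\<Xi> (Suc n)) y * complex_of_real (h y)) x
             = rep (\<Xi> n) x * complex_of_real (h x)) \<and>
        bdd_above (range (\<lambda>n.
           \<integral>x. (transfer_op r m0 ^^ n) (\<lambda>y. (cmod (rep (\<Xi> n) y))\<^sup>2 * h y) x \<partial>\<mu>))},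
     vadd = (\<lambda>\<Xi> \<Psi> n. vadd (L2 (omega r \<mu> m0 h n)) (\<Xi> n) (\<Psi> n)),
     vzero = (\<lambda>n. vzero (L2 (omega r \<mu> m0 h n))),
     vscale = (\<lambda>c \<Xi> n. vscale (L2 (omega r \<mu> m0 h n)) c (\<Xi> n)),
     vinner = (\<lambda>\<Xi> \<Psi>. lim (\<lambda>n.
        \<integral>x. (transfer_op r m0 ^^ n)
              (\<lambda>y. cnj (rep (\<Xi> n) y) * rep (\<Psi> n) y * complex_of_real (h y)) x \<partial>\<mu>))\<rparr>"

definition Phi ::
    "(nat \<Rightarrow> 'a measure) \<Rightarrow> (nat \<Rightarrow> 'a) measure
      \<Rightarrow> ((nat \<Rightarrow> 'a) \<Rightarrow> complex) set \<Rightarrow> nat \<Rightarrow> ('a \<Rightarrow> complex) set" where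
  "Phi \<omega> M F = (\<lambda>n. inv_into (vcarrier (L2 (\<omega> n))) (i_map M n)
                      (orthogonal_projection (L2 M) (H_sub \<omega> M n) F))"

end

theory Submission
  imports Defs
begin

text \<open>Strong invariance says that averaging over the fibres of \<open>r\<close> preserves \<open>\<mu>\<close>-integrals. Since
  \<open>R\<^sup>n f\<close> is the \<open>n\<close>-fold fibre average of \<open>w\<^sub>n f\<close> with \<open>w\<^sub>n = \<Prod>\<^bsub>k<n\<^esub> |m\<^sub>0 \<circ> r\<^sup>k|\<^sup>2\<close>, the measure \<open>\<omega>\<^sub>n\<close> has
  density \<open>w\<^sub>n h\<close> with respect to \<open>\<mu>\<close>, and \<open>R (\<xi>\<^sub>n\<^sub>+\<^sub>1 h) = \<xi>\<^sub>n h\<close> says that \<open>\<xi>\<^sub>n \<circ> \<theta>\<^sub>n\<close> is the conditional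
  expectation of \<open>\<xi>\<^sub>n\<^sub>+\<^sub>1 \<circ> \<theta>\<^sub>n\<^sub>+\<^sub>1\<close>. The target space thus consists of the martingales bounded in
  \<open>L\<^sup>2\<close>, which converge by orthogonality of increments, and \<open>\<Phi>\<close> maps a function to the martingale of its
  projections. The component \<open>\<Phi>(f)\<^sub>n\<close> is the adjoint of \<open>i\<^sub>n\<close> applied to \<open>f\<close>, so the formulas for the
  operators are verified by testing against functions of \<open>\<theta>\<^sub>n\<close>.\<close>

section \<open>Hilbert spaces\<close>

text \<open>Completeness of the target is not attacked directly: \<open>components\<close> is shown
  to be a bijection onto the bounded martingales that respects the operations and the limit inner
  product, and the Hilbert space axioms are carried over along it. That argument is geometric and
  sees only isometric embeddings with increasing ranges and trivial common orthogonal complement;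
  measure theory is confined to verifying these properties and to translating the condition on
  \<open>R\<close>. Two relations between consecutive levels do the work there. Pushing
  \<open>\<omega> (Suc n)\<close> forward by \<open>r\<close> gives \<open>\<omega> n\<close>, which
  makes the ranges increase; and on the same base \<open>\<omega> (Suc n)\<close> has density |m0 o
  r^n|^2 with respect to \<open>\<omega> n\<close>, which makes \<open>U\<close> isometric and
  shifts the index in its formula. The obstacle is measurability and null sets: fibres are not
  assumed to depend measurably on the base point, \<open>m0\<close> and \<open>h\<close> may vanish,
  and \<open>h\<close> is nonnegative and fixed only almost everywhere, so pointwise facts must be
  spread over almost all fibres before \<open>R\<close> can be applied to them.\<close>

context complex_hilbert_space
begin

lemma diff_closed: "u \<in> vcarrier H \<Longrightarrow> v \<in> vcarrier H \<Longrightarrow> vdiff H u v \<in> vcarrier H"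
  by (simp add: vdiff_def add_closed scale_closed)

lemma inner_add_left:
  "u \<in> vcarrier H \<Longrightarrow> v \<in> vcarrier H \<Longrightarrow> w \<in> vcarrier H \<Longrightarrow>
    vinner H (vadd H u v) w = vinner H u w + vinner H v w"
  by (metis add_closed complex_cnj_add inner_add_right inner_commute)

lemma inner_scale_left:
  "u \<in> vcarrier H \<Longrightarrow> v \<in> vcarrier H \<Longrightarrow> vinner H (vscale H c u) v = cnj c * vinner H u v"
  by (metis complex_cnj_mult inner_commute inner_scale_right scale_closed)

lemma inner_diff_right:
  "u \<in> vcarrier H \<Longrightarrow> v \<in> vcarrier H \<Longrightarrow> w \<in> vcarrier H \<Longrightarrow>
    vinner H u (vdiff H v w) = vinner H u v - vinner H u w"
  by (simp add: vdiff_def inner_add_right inner_scale_right scale_closed)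

lemma inner_diff_left:
  "u \<in> vcarrier H \<Longrightarrow> v \<in> vcarrier H \<Longrightarrow> w \<in> vcarrier H \<Longrightarrow>
    vinner H (vdiff H u v) w = vinner H u w - vinner H v w"
  by (simp add: vdiff_def inner_add_left inner_scale_left scale_closed)

lemma inner_self: "u \<in> vcarrier H \<Longrightarrow> vinner H u u = of_real (Re (vinner H u u))"
  using inner_commute[of u u] by (simp add: complex_eq_iff)

lemma vnorm_square: "u \<in> vcarrier H \<Longrightarrow> (vnorm H u)\<^sup>2 = Re (vinner H u u)"
  by (simp add: vnorm_def inner_nonneg)

lemma vnorm_nonneg: "u \<in> vcarrier H \<Longrightarrow> vnorm H u \<ge> 0"
  by (simp add: vnorm_def inner_nonneg)

lemma Re_inner_commute:
  "u \<in> vcarrier H \<Longrightarrow> v \<in> vcarrier H \<Longrightarrow> Re (vinner H u v) = Re (vinner H v u)"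
  using inner_commute[of u v] by simp

lemma diff_eq_zeroD:
  assumes "u \<in> vcarrier H" "v \<in> vcarrier H" "vdiff H u v = vzero H"
  shows "u = v"
proof -
  let ?w = "vscale H (-1) v"
  have w: "?w \<in> vcarrier H" using assms by (simp add: scale_closed)
  have "vadd H ?w v = vzero H"
    using diff_self[OF assms(2)] add_commute[OF assms(2) w] by (simp add: vdiff_def)
  then have "u = vadd H u (vadd H ?w v)" using assms by (simp add: add_zero)
  also have "\<dots> = vadd H (vzero H) v"
    using add_assoc[OF assms(1) w assms(2)] assms(3) by (simp add: vdiff_def)
  also have "\<dots> = v" using assms zero_closed by (metis add_commute add_zero)
  finally show ?thesis .
qed

lemma inner_zero_right: "u \<in> vcarrier H \<Longrightarrow> vinner H u (vzero H) = 0"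
  using inner_add_right[of u "vzero H" "vzero H"] add_zero[OF zero_closed] zero_closed by auto

lemma inner_zero_left: "u \<in> vcarrier H \<Longrightarrow> vinner H (vzero H) u = 0"
  using inner_zero_right[of u] inner_commute[of "vzero H" u] zero_closed by simp

lemma norm_diff_square:
  assumes "u \<in> vcarrier H" "v \<in> vcarrier H"
  shows "(vnorm H (vdiff H u v))\<^sup>2
    = Re (vinner H u u) + Re (vinner H v v) - 2 * Re (vinner H u v)"
  using assms Re_inner_commute[OF assms]
  by (simp add: vnorm_square diff_closed inner_diff_left inner_diff_right)

lemma Cauchy_Schwarz:
  assumes u: "u \<in> vcarrier H" and v: "v \<in> vcarrier H"
  shows "cmod (vinner H u v) \<le> vnorm H u * vnorm H v"
proof (cases "Re (vinner H u u) = 0")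
  case True
  then have "u = vzero H" using inner_eq_zero[OF u] inner_self[OF u] by simp
  then show ?thesis using v by (simp add: inner_zero_left vnorm_nonneg zero_closed)
next
  case False
  then have pos: "Re (vinner H u u) > 0" using inner_nonneg[OF u] by simp
  define a where "a = Re (vinner H u u)"
  define c where "c = vinner H u v"
  have uu: "vinner H u u = of_real a" using inner_self[OF u] by (simp add: a_def)
  have vu: "vinner H v u = cnj c" using inner_commute[OF v u] by (simp add: c_def)
  have cc: "cnj c * c = of_real ((cmod c)\<^sup>2)" "c * cnj c = of_real ((cmod c)\<^sup>2)"
    by (simp_all add: complex_norm_square mult.commute del: of_real_power)
  \<comment> \<open>Up to the factor \<open>a\<close>, this is the part of \<open>v\<close>
    orthogonal to \<open>u\<close>; clearing the denominator avoids a division.\<close>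
  let ?w = "vdiff H (vscale H (of_real a) v) (vscale H c u)"
  have "vinner H ?w ?w = of_real (a * (a * Re (vinner H v v) - (cmod c)\<^sup>2))"
    using u v inner_self[OF v] 
    by (simp add: inner_diff_left inner_diff_right inner_scale_left inner_scale_right scale_closed
        diff_closed uu vu c_def[symmetric] algebra_simps cc del: of_real_power)
  then have "a * (a * Re (vinner H v v) - (cmod c)\<^sup>2) \<ge> 0"
    using inner_nonneg[of ?w] u v by (simp add: diff_closed scale_closed)
  then have "(cmod c)\<^sup>2 \<le> a * Re (vinner H v v)"
    using pos by (simp add: a_def zero_le_mult_iff)
  then have "(cmod c)\<^sup>2 \<le> (vnorm H u * vnorm H v)\<^sup>2"
    using u v by (simp add: power_mult_distrib vnorm_square a_def)
  then show ?thesis unfolding c_def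
    by (rule power2_le_imp_le) (simp add: vnorm_nonneg u v)
qed

lemma tendsto_inner:
  assumes "\<And>n. s n \<in> vcarrier H" "a \<in> vcarrier H" "\<And>n. t n \<in> vcarrier H" "b \<in> vcarrier H"
    and "(\<lambda>n. vnorm H (vdiff H (s n) a)) \<longlonglongrightarrow> 0" "(\<lambda>n. vnorm H (vdiff H (t n) b)) \<longlonglongrightarrow> 0"
  shows "(\<lambda>n. vinner H (s n) (t n)) \<longlonglongrightarrow> vinner H a b"
proof -
  have lim0: "(\<lambda>n. vinner H (x n) (y n)) \<longlonglongrightarrow> 0"
    if "\<And>n. x n \<in> vcarrier H" "\<And>n. y n \<in> vcarrier H" "(\<lambda>n. vnorm H (x n) * vnorm H (y n)) \<longlonglongrightarrow> 0"
    for x y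
    by (rule Lim_null_comparison[OF _ that(3)]) (simp add: Cauchy_Schwarz that)
  let ?x = "\<lambda>n. vdiff H (s n) a" and ?y = "\<lambda>n. vdiff H (t n) b"
  have "(\<lambda>n. vinner H (?x n) (?y n) + vinner H a (?y n) + vinner H (?x n) b + vinner H a b)
      \<longlonglongrightarrow> 0 + 0 + 0 + vinner H a b"
    by (intro tendsto_add lim0 tendsto_const)
      (auto simp: diff_closed assms(1-4) intro!: tendsto_mult_zero assms(5,6) tendsto_mult_left_zero tendsto_mult_right_zero)
  then show ?thesis
    by (simp add: inner_diff_left inner_diff_right diff_closed assms(1-4))
qed

lemma tendsto_inner_right:
  assumes "a \<in> vcarrier H" "\<And>n. t n \<in> vcarrier H" "b \<in> vcarrier H"
    and "(\<lambda>n. vnorm H (vdiff H (t n) b)) \<longlonglongrightarrow> 0"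
  shows "(\<lambda>n. vinner H a (t n)) \<longlonglongrightarrow> vinner H a b"
proof (rule tendsto_inner[OF assms(1,1,2,3) _ assms(4)])
  have "vnorm H (vdiff H a a) = 0"
    using assms by (simp add: diff_self vnorm_def inner_zero_right zero_closed)
  then show "(\<lambda>n. vnorm H (vdiff H a a)) \<longlonglongrightarrow> 0" by simp
qed

text \<open>A minimising sequence for the distance to \<open>v\<close> is Cauchy by the
  parallelogram law, and its limit is the projection by a variational argument. Closedness is
  sequential because \<open>vnorm\<close> belongs to the record and comes with no topology on the
  type.\<close>

lemma ex_orthogonal_projection:
  assumes S: "S \<subseteq> vcarrier H" "S \<noteq> {}"
    and add: "\<And>u v. u \<in> S \<Longrightarrow> v \<in> S \<Longrightarrow> vadd H u v \<in> S"
    and scale: "\<And>c u. u \<in> S \<Longrightarrow> vscale H c u \<in> S"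
    and closed: "\<And>s l. (\<And>n. s n \<in> S) \<Longrightarrow> l \<in> vcarrier H \<Longrightarrow>
      (\<lambda>n. vnorm H (vdiff H (s n) l)) \<longlonglongrightarrow> 0 \<Longrightarrow> l \<in> S"
    and v: "v \<in> vcarrier H"
  obtains p where "p \<in> S" "\<And>s. s \<in> S \<Longrightarrow> vinner H s (vdiff H v p) = 0"
proof -
  define q where "q s = Re (vinner H (vdiff H v s) (vdiff H v s))" for s
  have Sc: "s \<in> vcarrier H" if "s \<in> S" for s using S that by auto
  have q_nonneg: "q s \<ge> 0" if "s \<in> S" for s
    using inner_nonneg[of "vdiff H v s"] that by (auto simp: q_def diff_closed v Sc)
  have q: "q s = Re (vinner H v v) + Re (vinner H s s) - 2 * Re (vinner H v s)" if "s \<in> S" for s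
    using norm_diff_square[of v s] that by (simp add: vnorm_square diff_closed v Sc q_def)
  define d where "d = Inf (q ` S)"
  have bdd: "bdd_below (q ` S)" using q_nonneg by (intro bdd_belowI[of _ 0]) auto
  have d_le: "d \<le> q s" if "s \<in> S" for s
    unfolding d_def using bdd that by (intro cInf_lower) auto
  have "\<exists>s\<in>S. q s < d + 1 / Suc n" for n
    using cInf_lessD[of "q ` S" "d + 1 / Suc n"] S(2) by (auto simp: d_def)
  then obtain s where s: "\<And>n. s n \<in> S" "\<And>n. q (s n) < d + 1 / Suc n" by metis
  have sc: "s n \<in> vcarrier H" for n using s Sc by auto
  \<comment> \<open>Parallelogram law: the midpoint \<open>?t\<close> lies in \<open>S\<close>, so
    its squared distance to \<open>v\<close> is at least \<open>d\<close>.\<close>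
  have half: "(vnorm H (vdiff H (s m) (s n)))\<^sup>2 \<le> 2 * (q (s m) - d) + 2 * (q (s n) - d)" for m n
  proof -
    let ?t = "vscale H (1/2) (vadd H (s m) (s n))"
    have "?t \<in> S" by (intro scale add s)
    then have "4 * d \<le> 4 * q ?t" using d_le by simp
    also have "4 * q ?t = 4 * Re (vinner H v v) + Re (vinner H (s m) (s m)) + Re (vinner H (s n) (s n))
        + 2 * Re (vinner H (s m) (s n)) - 4 * Re (vinner H v (s m)) - 4 * Re (vinner H v (s n))"
      using \<open>?t \<in> S\<close> Re_inner_commute[OF sc sc, of m n]
      by (simp add: q inner_scale_right inner_scale_left inner_add_left inner_add_right v sc
          add_closed scale_closed field_simps)
    finally show ?thesis
      by (simp add: norm_diff_square sc q s)
  qed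
  have "\<exists>N. \<forall>m\<ge>N. \<forall>n\<ge>N. vnorm H (vdiff H (s m) (s n)) < e" if "e > 0" for e
  proof -
    obtain N where N: "inverse (real (Suc N)) < e\<^sup>2 / 4"
      using reals_Archimedean[of "e\<^sup>2 / 4"] \<open>e > 0\<close> by auto
    have "vnorm H (vdiff H (s m) (s n)) < e" if "m \<ge> N" "n \<ge> N" for m n
    proof -
      have small: "q (s k) - d < e\<^sup>2 / 4" if "k \<ge> N" for k
      proof -
        have "1 / real (Suc k) \<le> 1 / Suc N" using that by (simp add: field_simps)
        then show ?thesis using s(2)[of k] N by (simp add: inverse_eq_divide)
      qed
      have "(vnorm H (vdiff H (s m) (s n)))\<^sup>2 < e\<^sup>2"
        using half[of m n] small[of m] small[of n] that by simp
      then show ?thesis using \<open>e > 0\<close> by (simp add: power2_less_imp_less)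
    qed
    then show ?thesis by blast
  qed
  then obtain p where p: "p \<in> vcarrier H" "(\<lambda>n. vnorm H (vdiff H (s n) p)) \<longlonglongrightarrow> 0"
    using complete[of s] sc by blast
  have pS: "p \<in> S" using closed[of s p] s p by blast
  have "(\<lambda>n. Re (vinner H v v) + Re (vinner H (s n) (s n)) - 2 * Re (vinner H v (s n)))
      \<longlonglongrightarrow> Re (vinner H v v) + Re (vinner H p p) - 2 * Re (vinner H v p)"
    by (intro tendsto_intros tendsto_inner tendsto_inner_right sc p v)
  then have "(\<lambda>n. q (s n)) \<longlonglongrightarrow> q p" using s pS by (simp add: q)
  moreover have "(\<lambda>n. d + 1 / Suc n) \<longlonglongrightarrow> d + 0"
    using LIMSEQ_inverse_real_of_nat by (intro tendsto_add tendsto_const) (simp add: inverse_eq_divide)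
  ultimately have qp: "q p \<le> d"
    using s(2) by (intro LIMSEQ_le[of "\<lambda>n. q (s n)" _ "\<lambda>n. d + 1 / Suc n"]) (auto intro: less_imp_le)
  have orth: "vinner H x (vdiff H v p) = 0" if x: "x \<in> S" for x
  proof -
    define b where "b = vinner H x (vdiff H v p)"
    define a where "a = Re (vinner H x x)"
    have xc: "x \<in> vcarrier H" using x Sc by simp
    have a0: "a \<ge> 0" using inner_nonneg[OF xc] by (simp add: a_def)
    \<comment> \<open>Compare the minimiser \<open>p\<close> with \<open>p + t b x\<close>. The
      coefficient is aligned with \<open>b\<close>, so the first-order term becomes -2 t |b|^2 and
      only a real parameter remains.\<close>
    have ineq: "2 * t * (cmod b)\<^sup>2 \<le> t\<^sup>2 * (cmod b)\<^sup>2 * a" for t :: real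
    proof -
      define c where "c = of_real t * b"
      define y where "y = vinner H x p"
      define z where "z = vinner H x v"
      let ?s = "vadd H p (vscale H c x)"
      have sS: "?s \<in> S" by (intro add scale pS x)
      have e1: "vinner H v x = cnj z" "vinner H p x = cnj y"
        unfolding y_def z_def using v p xc by (blast intro: inner_commute)+
      have bz: "b = z - y" by (simp add: b_def y_def z_def inner_diff_right xc v p)
      have ss: "vinner H ?s ?s = vinner H p p + c * cnj y + (cnj c * y + cnj c * c * vinner H x x)"
        using p xc
        by (simp add: inner_add_left inner_add_right inner_scale_left inner_scale_right
            scale_closed add_closed e1 y_def[symmetric] distrib_left mult.assoc)
      have vs: "vinner H v ?s = vinner H v p + c * cnj z"
        using p xc v by (simp add: inner_add_right inner_scale_right scale_closed e1)
      have re: "Re (c * cnj y) = Re (cnj c * y)" "Re (c * cnj z) = Re (cnj c * z)" by simp_all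
      \<comment> \<open>Here \<open>C\<close> and \<open>F\<close> stand for the real parts of
        \<open>cnj c * y\<close> and \<open>cnj c * z\<close>; their difference is the first-order
        term.\<close>
      have lin: "A + (B + C + (C + E)) - 2 * (D + F) = A + B - 2 * D + E - (2 * F - 2 * C)"
        for A B C D E F :: real by simp
      have "q ?s = q p + Re (cnj c * c * vinner H x x) - 2 * Re (cnj c * b)"
        unfolding q[OF sS] q[OF pS] bz ss vs right_diff_distrib plus_complex.sel minus_complex.sel re
        by (rule lin)
      moreover have "cnj c * c = of_real (t\<^sup>2 * (cmod b)\<^sup>2)" "cnj c * b = of_real (t * (cmod b)\<^sup>2)"
      proof -
        have "cnj b * b = of_real ((cmod b)\<^sup>2)" by (metis complex_norm_square mult.commute)
        moreover have "cnj c * c = of_real (t\<^sup>2) * (cnj b * b)" "cnj c * b = of_real t * (cnj b * b)"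
          by (simp_all add: c_def power2_eq_square mult_ac)
        ultimately show "cnj c * c = of_real (t\<^sup>2 * (cmod b)\<^sup>2)" "cnj c * b = of_real (t * (cmod b)\<^sup>2)"
          by simp_all
      qed
      ultimately have "q ?s = q p + t\<^sup>2 * (cmod b)\<^sup>2 * a - 2 * (t * (cmod b)\<^sup>2)"
        by (simp add: a_def del: of_real_mult of_real_power)
      then show ?thesis using d_le[OF sS] qp by simp
    qed
    \<comment> \<open>For \<open>a > 0\<close> the best parameter is t = 1/a; for
      \<open>a = 0\<close> the quadratic term is absent and t = 1 suffices.\<close>
    have "(cmod b)\<^sup>2 \<le> 0"
    proof (cases "a = 0")
      case True then show ?thesis using ineq[of 1] by simp
    next
      case False
      then show ?thesis using ineq[of "1/a"] a0
        by (simp add: power2_eq_square field_simps)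
    qed
    then show ?thesis by (simp add: b_def)
  qed
  show ?thesis by (rule that[OF pS orth])
qed

end

text \<open>\<open>K\<close> starts as a bare record, so this is how the sequence space becomes a
  Hilbert space; Cauchy sequences are pulled back to \<open>H\<close> and their limits pushed
  forward.\<close>

lemma complex_hilbert_space_transport:
  assumes "complex_hilbert_space H" and bij: "bij_betw T (vcarrier H) (vcarrier K)"
    and zero: "T (vzero H) = vzero K"
    and add: "\<And>u v. u \<in> vcarrier H \<Longrightarrow> v \<in> vcarrier H \<Longrightarrow> T (vadd H u v) = vadd K (T u) (T v)"
    and scale: "\<And>c u. u \<in> vcarrier H \<Longrightarrow> T (vscale H c u) = vscale K c (T u)"
    and inner: "\<And>u v. u \<in> vcarrier H \<Longrightarrow> v \<in> vcarrier H \<Longrightarrow> vinner K (T u) (T v) = vinner H u v"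
  shows "complex_hilbert_space K"
proof -
  interpret complex_hilbert_space H by fact
  have img: "vcarrier K = T ` vcarrier H" using bij by (simp add: bij_betw_def)
  note simps = add[symmetric] scale[symmetric] zero[symmetric] inner add_closed scale_closed zero_closed
  have diff: "vdiff K (T u) (T v) = T (vdiff H u v)" if "u \<in> vcarrier H" "v \<in> vcarrier H" for u v
    using that by (simp add: vdiff_def simps)
  have norm: "vnorm K (T u) = vnorm H u" if "u \<in> vcarrier H" for u
    using that by (simp add: vnorm_def inner)
  show ?thesis
  proof
    show "vzero K \<in> vcarrier K" by (simp add: img simps)
  next
    fix u v assume "u \<in> vcarrier K" "v \<in> vcarrier K"
    then show "vadd K u v \<in> vcarrier K" "vadd K u v = vadd K v u"
      "vinner K u v = cnj (vinner K v u)"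
      unfolding img by (auto simp: simps intro: arg_cong[OF add_commute] inner_commute)
  next
    fix u c assume "u \<in> vcarrier K"
    then show "vscale K c u \<in> vcarrier K" by (auto simp: img simps)
  next
    fix u v w assume "u \<in> vcarrier K" "v \<in> vcarrier K" "w \<in> vcarrier K"
    then show "vadd K (vadd K u v) w = vadd K u (vadd K v w)"
      "vinner K u (vadd K v w) = vinner K u v + vinner K u w"
      unfolding img by (auto simp: simps add_assoc inner_add_right)
  next
    fix u assume "u \<in> vcarrier K"
    then show "vadd K u (vzero K) = u" "vdiff K u u = vzero K" "vscale K 1 u = u"
      "0 \<le> Re (vinner K u u)"
      unfolding img by (auto simp: simps add_zero diff diff_self scale_one inner_nonneg)
  next
    fix u v c assume "u \<in> vcarrier K" "v \<in> vcarrier K"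
    then show "vscale K c (vadd K u v) = vadd K (vscale K c u) (vscale K c v)"
      "vinner K u (vscale K c v) = c * vinner K u v"
      unfolding img by (auto simp: simps scale_add_right inner_scale_right)
  next
    fix u c d assume "u \<in> vcarrier K"
    then show "vscale K (c + d) u = vadd K (vscale K c u) (vscale K d u)"
      "vscale K c (vscale K d u) = vscale K (c * d) u"
      unfolding img by (auto simp: simps scale_add_left scale_scale)
  next
    fix u assume "u \<in> vcarrier K" "vinner K u u = 0"
    then show "u = vzero K" unfolding img by (auto simp: simps dest: inner_eq_zero)
  next
    fix s :: "nat \<Rightarrow> _" assume s: "\<And>n. s n \<in> vcarrier K"
      and cauchy: "\<forall>e>0. \<exists>N. \<forall>m\<ge>N. \<forall>n\<ge>N. vnorm K (vdiff K (s m) (s n)) < e"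
    have "\<forall>n. \<exists>t. t \<in> vcarrier H \<and> s n = T t" using s img by auto
    then obtain t where t: "\<And>n. t n \<in> vcarrier H" "\<And>n. s n = T (t n)" by metis
    have "\<exists>l\<in>vcarrier H. (\<lambda>n. vnorm H (vdiff H (t n) l)) \<longlonglongrightarrow> 0"
      using cauchy t by (intro complete) (auto simp: diff norm diff_closed)
    then show "\<exists>l\<in>vcarrier K. (\<lambda>n. vnorm K (vdiff K (s n) l)) \<longlonglongrightarrow> 0"
      using t by (auto simp: img diff norm diff_closed)
  qed
qed

section \<open>Isometric embeddings and their adjoints\<close>

locale isometric_embedding = K: complex_hilbert_space K + L: complex_hilbert_space L
  for K :: "('v, 'm) complex_space_scheme" and L :: "('w, 'k) complex_space_scheme" +
  fixes i :: "'w \<Rightarrow> 'v"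
  assumes closed: "x \<in> vcarrier L \<Longrightarrow> i x \<in> vcarrier K"
    and add: "\<lbrakk>x \<in> vcarrier L; y \<in> vcarrier L\<rbrakk> \<Longrightarrow> i (vadd L x y) = vadd K (i x) (i y)"
    and scale: "x \<in> vcarrier L \<Longrightarrow> i (vscale L c x) = vscale K c (i x)"
    and inner: "\<lbrakk>x \<in> vcarrier L; y \<in> vcarrier L\<rbrakk> \<Longrightarrow> vinner K (i x) (i y) = vinner L x y"
begin

text \<open>The Hilbert space adjoint of \<open>i\<close>, written in exactly the form of one
  component of \<open>Phi\<close> so that the two agree by unfolding.\<close>

definition adj :: "'v \<Rightarrow> 'w" where
  "adj v = inv_into (vcarrier L) i (orthogonal_projection K (i ` vcarrier L) v)"

lemma diff: "x \<in> vcarrier L \<Longrightarrow> y \<in> vcarrier L \<Longrightarrow> i (vdiff L x y) = vdiff K (i x) (i y)"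
  by (simp add: vdiff_def add scale L.scale_closed)

lemma norm: "x \<in> vcarrier L \<Longrightarrow> vnorm K (i x) = vnorm L x"
  by (simp add: vnorm_def inner)

lemma eq_zero: "x \<in> vcarrier L \<Longrightarrow> vinner K (i x) (i x) = 0 \<Longrightarrow> x = vzero L"
  using L.inner_eq_zero inner by simp

lemma inj: "inj_on i (vcarrier L)"
proof (rule inj_onI)
  fix x y assume xy: "x \<in> vcarrier L" "y \<in> vcarrier L" "i x = i y"
  then have "vdiff L x y = vzero L"
    using K.diff_self[OF closed[of y]]
    by (intro eq_zero) (simp_all add: L.diff_closed diff K.inner_zero_right K.zero_closed closed)
  then show "x = y" using xy L.diff_eq_zeroD by blast
qed

text \<open>The isometry turns a convergent sequence in the range into a Cauchy sequence in the
  complete space \<open>L\<close>; the image of its limit there must be \<open>l\<close>.\<close>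

lemma range_closed:
  assumes s: "\<And>n. s n \<in> i ` vcarrier L" and l: "l \<in> vcarrier K"
    and lim: "(\<lambda>n. vnorm K (vdiff K (s n) l)) \<longlonglongrightarrow> 0"
  shows "l \<in> i ` vcarrier L"
proof -
  have "\<forall>n. \<exists>t. t \<in> vcarrier L \<and> s n = i t" using s by auto
  then obtain t where t: "\<And>n. t n \<in> vcarrier L" "\<And>n. s n = i (t n)" by metis
  have sc: "s n \<in> vcarrier K" for n by (simp add: t closed)
  have "\<exists>N. \<forall>m\<ge>N. \<forall>n\<ge>N. vnorm L (vdiff L (t m) (t n)) < e" if "e > 0" for e
  proof -
    have "\<forall>\<^sub>F n in sequentially. vnorm K (vdiff K (s n) l) < e / 2"
      using lim that by (intro order_tendstoD(2)[where y=0]) auto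
    then obtain N where N: "\<And>n. n \<ge> N \<Longrightarrow> vnorm K (vdiff K (s n) l) < e / 2"
      by (auto simp: eventually_sequentially)
    have "vnorm L (vdiff L (t m) (t n)) < e" if "m \<ge> N" "n \<ge> N" for m n
    proof -
      let ?u = "vdiff K (s m) l" and ?v = "vdiff K (s n) l"
      have uv: "?u \<in> vcarrier K" "?v \<in> vcarrier K" by (simp_all add: K.diff_closed sc l)
      \<comment> \<open>The triangle inequality through \<open>l\<close>, derived from
        Cauchy-Schwarz by expanding the square.\<close>
      have "(vnorm K (vdiff K (s m) (s n)))\<^sup>2
          = (vnorm K ?u)\<^sup>2 + (vnorm K ?v)\<^sup>2 - 2 * Re (vinner K ?u ?v)"
        using K.Re_inner_commute[OF l sc, of m] K.Re_inner_commute[OF l sc, of n]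
        by (simp add: K.norm_diff_square sc l K.inner_diff_left K.inner_diff_right K.diff_closed)
      also have "\<dots> \<le> (vnorm K ?u)\<^sup>2 + (vnorm K ?v)\<^sup>2 + 2 * (vnorm K ?u * vnorm K ?v)"
        using K.Cauchy_Schwarz[OF uv] abs_Re_le_cmod[of "vinner K ?u ?v"] by linarith
      also have "\<dots> = (vnorm K ?u + vnorm K ?v)\<^sup>2" by (simp add: power2_sum)
      finally have "vnorm K (vdiff K (s m) (s n)) \<le> vnorm K ?u + vnorm K ?v"
        by (rule power2_le_imp_le) (simp add: K.vnorm_nonneg uv)
      also have "\<dots> < e" using N[of m] N[of n] that by simp
      finally show ?thesis by (simp add: t diff[symmetric] norm L.diff_closed)
    qed
    then show ?thesis by blast
  qed
  then obtain k where k: "k \<in> vcarrier L" "(\<lambda>n. vnorm L (vdiff L (t n) k)) \<longlonglongrightarrow> 0"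
    using L.complete[of t] t by blast
  then have lim': "(\<lambda>n. vnorm K (vdiff K (s n) (i k))) \<longlonglongrightarrow> 0"
    by (simp add: t diff[symmetric] norm L.diff_closed)
  let ?w = "vdiff K (i k) l"
  have w: "?w \<in> vcarrier K" using k l closed K.diff_closed by simp
  \<comment> \<open>Uniqueness of norm limits: both candidates have the same inner product with
    their difference \<open>?w\<close>, hence \<open>?w\<close> is orthogonal to itself.\<close>
  have "vinner K ?w (i k) = vinner K ?w l"
    using K.tendsto_inner_right[OF w sc closed[OF k(1)] lim'] K.tendsto_inner_right[OF w sc l lim]
    by (rule LIMSEQ_unique)
  then have "?w = vzero K"
    using w k l by (intro K.inner_eq_zero) (auto simp: K.inner_diff_right closed)
  then show ?thesis using K.diff_eq_zeroD k l closed by blast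
qed

text \<open>Besides naming the adjoint, this settles the uniqueness hidden in the definite
  description of \<open>orthogonal_projection\<close>: the difference of two candidates lies in the
  range and is orthogonal to it. Every later formula for \<open>Phi\<close> is obtained through
  it.\<close>

lemma adj_unique:
  assumes v: "v \<in> vcarrier K" and y: "y \<in> vcarrier L"
    and eq: "\<And>x. x \<in> vcarrier L \<Longrightarrow> vinner L x y = vinner K (i x) v"
  shows "adj v = y"
proof -
  have "orthogonal_projection K (i ` vcarrier L) v = i y"
    unfolding orthogonal_projection_def
  proof (rule the_equality)
    show "i y \<in> i ` vcarrier L \<and> (\<forall>s\<in>i ` vcarrier L. vinner K s (vdiff K v (i y)) = 0)"
      using v y eq by (auto simp: K.inner_diff_right closed inner)
  next
    fix p assume p: "p \<in> i ` vcarrier L \<and> (\<forall>s\<in>i ` vcarrier L. vinner K s (vdiff K v p) = 0)"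
    then obtain z where z: "z \<in> vcarrier L" "p = i z" by auto
    let ?d = "vdiff L y z"
    have d: "?d \<in> vcarrier L" using y z L.diff_closed by simp
    have "vinner K (i ?d) (vdiff K v (i z)) = 0" using p z d by auto
    then have "vinner L ?d ?d = 0"
      using v y z d eq[OF d] by (simp add: K.inner_diff_right L.inner_diff_right closed inner)
    then show "p = i y" using L.inner_eq_zero[OF d] L.diff_eq_zeroD y z by auto
  qed
  then show ?thesis by (simp add: adj_def inj y)
qed

text \<open>The range is a closed subspace, so a projection exists; its preimage satisfies the
  hypothesis of \<open>adj_unique\<close>.\<close>

lemma adj:
  assumes v: "v \<in> vcarrier K"
  shows adj_closed: "adj v \<in> vcarrier L"
    and inner_adj: "x \<in> vcarrier L \<Longrightarrow> vinner L x (adj v) = vinner K (i x) v"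
proof -
  obtain p where p: "p \<in> i ` vcarrier L" "\<And>s. s \<in> i ` vcarrier L \<Longrightarrow> vinner K s (vdiff K v p) = 0"
  proof (atomize_elim, rule K.ex_orthogonal_projection[of "i ` vcarrier L" v])
    show "vadd K u w \<in> i ` vcarrier L" if "u \<in> i ` vcarrier L" "w \<in> i ` vcarrier L" for u w
      using that by (auto simp: add[symmetric] L.add_closed)
    show "vscale K c u \<in> i ` vcarrier L" if "u \<in> i ` vcarrier L" for c u
      using that by (auto simp: scale[symmetric] L.scale_closed)
    show "l \<in> i ` vcarrier L" if "\<And>n. s n \<in> i ` vcarrier L" "l \<in> vcarrier K"
      "(\<lambda>n. vnorm K (vdiff K (s n) l)) \<longlonglongrightarrow> 0" for s l
      using that by (rule range_closed)
  qed (use closed L.zero_closed v in blast)+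
  then obtain y where y: "y \<in> vcarrier L" "p = i y" by auto
  have eq: "vinner L x y = vinner K (i x) v" if "x \<in> vcarrier L" for x
    using p(2)[of "i x"] y that v by (simp add: K.inner_diff_right closed inner)
  have "adj v = y" by (rule adj_unique[OF v y(1) eq])
  then show "adj v \<in> vcarrier L" "x \<in> vcarrier L \<Longrightarrow> vinner L x (adj v) = vinner K (i x) v"
    using y eq by auto
qed

end

section \<open>Bounded martingales along an increasing sequence of subspaces\<close>

locale isometric_tower = K: complex_hilbert_space K
  for K :: "('v, 'm) complex_space_scheme" +
  fixes L :: "nat \<Rightarrow> ('w, 'k) complex_space_scheme" and i :: "nat \<Rightarrow> 'w \<Rightarrow> 'v"
  assumes emb: "isometric_embedding K (L n) (i n)"
    and increasing: "i n ` vcarrier (L n) \<subseteq> i (Suc n) ` vcarrier (L (Suc n))"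
    and total: "\<lbrakk>v \<in> vcarrier K; \<And>n x. x \<in> vcarrier (L n) \<Longrightarrow> vinner K (i n x) v = 0\<rbrakk>
      \<Longrightarrow> v = vzero K"

sublocale isometric_tower \<subseteq> I: isometric_embedding K "L n" "i n" for n
  by (rule emb)

context isometric_tower
begin

text \<open>The middle condition says in weak form that \<open>i n (\<Xi> n)\<close> is the
  projection of \<open>i (Suc n) (\<Xi> (Suc n))\<close> onto the range of \<open>i n\<close>. The
  weak form is what integration over fibres delivers for \<open>R\<close>.\<close>

definition bounded_martingales :: "(nat \<Rightarrow> 'w) set" where
  "bounded_martingales = {\<Xi>. (\<forall>n. \<Xi> n \<in> vcarrier (L n)) \<and>
     (\<forall>n. \<forall>x\<in>vcarrier (L n). vinner K (i n x) (i (Suc n) (\<Xi> (Suc n))) = vinner (L n) x (\<Xi> n)) \<and>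
     bdd_above (range (\<lambda>n. Re (vinner (L n) (\<Xi> n) (\<Xi> n))))}"

definition components :: "'v \<Rightarrow> nat \<Rightarrow> 'w" where
  "components v n = I.adj n v"

lemma range_mono: "m \<le> n \<Longrightarrow> i m ` vcarrier (L m) \<subseteq> i n ` vcarrier (L n)"
  using lift_Suc_mono_le[of "\<lambda>n. i n ` vcarrier (L n)"] increasing by blast

lemma martingale_limit:
  assumes \<Xi>: "\<Xi> \<in> bounded_martingales"
  obtains v where "v \<in> vcarrier K" "(\<lambda>n. vnorm K (vdiff K (i n (\<Xi> n)) v)) \<longlonglongrightarrow> 0"
    "components v = \<Xi>"
proof -
  have \<Xi>c: "\<Xi> n \<in> vcarrier (L n)" for n using \<Xi> by (auto simp: bounded_martingales_def)
  let ?F = "\<lambda>n. i n (\<Xi> n)" and ?q = "\<lambda>n. Re (vinner (L n) (\<Xi> n) (\<Xi> n))"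
  have Fc: "?F n \<in> vcarrier K" for n by (simp add: I.closed \<Xi>c)
  \<comment> \<open>The one-step condition extends to all later levels, because a vector from level
    \<open>n\<close> also lies in the range of every later embedding.\<close>
  have step: "vinner K (i n x) (?F m) = vinner (L n) x (\<Xi> n)"
    if mn: "m \<ge> n" and x: "x \<in> vcarrier (L n)" for m n x
    using mn
  proof (induction m rule: dec_induct)
    case base then show ?case by (simp add: I.inner x \<Xi>c)
  next
    case (step m)
    then obtain y where y: "y \<in> vcarrier (L m)" "i n x = i m y"
      using range_mono[of n m] x by blast
    then have "vinner K (i m y) (?F (Suc m)) = vinner (L m) y (\<Xi> m)"
      using \<Xi> by (auto simp: bounded_martingales_def)
    then show ?case using step y by (simp add: I.inner \<Xi>c)
  qed
  \<comment> \<open>Pythagoras, from \<open>step\<close> with the test vector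
    \<open>\<Xi> n\<close>: squared distances are differences of the bounded increasing sequence
    \<open>?q\<close>.\<close>
  have dist: "(vnorm K (vdiff K (?F m) (?F n)))\<^sup>2 = ?q m - ?q n" if "m \<ge> n" for m n
    using step[OF that \<Xi>c] K.Re_inner_commute[OF Fc Fc, of m n]
    by (simp add: K.norm_diff_square Fc I.inner \<Xi>c)
  have mono: "incseq ?q"
  proof (rule incseq_SucI)
    fix n show "?q n \<le> ?q (Suc n)" using dist[of n "Suc n"] zero_le_power2 by (metis diff_ge_0_iff_ge lessI less_imp_le)
  qed
  obtain B where "?q n \<le> B" for n
    using \<Xi> by (auto simp: bounded_martingales_def bdd_above_def)
  then have "Cauchy ?q"
    by (metis LIMSEQ_imp_Cauchy incseq_convergent[OF mono])
  have "\<exists>N. \<forall>m\<ge>N. \<forall>n\<ge>N. vnorm K (vdiff K (?F m) (?F n)) < e" if "e > 0" for e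
  proof -
    obtain N where N: "\<And>m n. m \<ge> N \<Longrightarrow> n \<ge> N \<Longrightarrow> \<bar>?q m - ?q n\<bar> < e\<^sup>2"
      using CauchyD[OF \<open>Cauchy ?q\<close>, of "e\<^sup>2"] \<open>e > 0\<close> by auto
    have "vnorm K (vdiff K (?F m) (?F n)) < e" if "m \<ge> N" "n \<ge> N" for m n
    proof -
      have "(vnorm K (vdiff K (?F m) (?F n)))\<^sup>2 = \<bar>?q m - ?q n\<bar>"
      proof (cases "m \<ge> n")
        case True
        then show ?thesis using dist[of n m] incseqD[OF mono True] by simp
      next
        case False
        have "(vnorm K (vdiff K (?F m) (?F n)))\<^sup>2 = (vnorm K (vdiff K (?F n) (?F m)))\<^sup>2"
          using K.Re_inner_commute[OF Fc Fc, of m n] by (simp add: K.norm_diff_square Fc)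
        then show ?thesis using False dist[of m n] incseqD[OF mono, of m n] by simp
      qed
      then show ?thesis using N[of m n] that \<open>e > 0\<close> by (simp add: power2_less_imp_less)
    qed
    then show ?thesis by blast
  qed
  then obtain v where v: "v \<in> vcarrier K" "(\<lambda>n. vnorm K (vdiff K (?F n) v)) \<longlonglongrightarrow> 0"
    using K.complete[of ?F] Fc by blast
  \<comment> \<open>Against a fixed test vector of level \<open>n\<close> the inner products are
    constant from index \<open>n\<close> on, so the limit \<open>v\<close> inherits that
    value.\<close>
  have "I.adj n v = \<Xi> n" for n
  proof (rule I.adj_unique)
    fix x assume x: "x \<in> vcarrier (L n)"
    have "(\<lambda>m. vinner K (i n x) (?F m)) \<longlonglongrightarrow> vinner K (i n x) v"
      by (intro K.tendsto_inner_right v Fc I.closed x)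
    moreover have "(\<lambda>m. vinner K (i n x) (?F m)) \<longlonglongrightarrow> vinner (L n) x (\<Xi> n)"
      by (intro tendsto_eventually eventually_sequentiallyI[of n] step x)
    ultimately show "vinner (L n) x (\<Xi> n) = vinner K (i n x) v" by (rule LIMSEQ_unique[symmetric])
  qed (use v \<Xi>c in auto)
  then show ?thesis using v by (intro that[of v]) (auto simp: components_def)
qed

lemma components_martingale:
  assumes v: "v \<in> vcarrier K"
  shows "components v \<in> bounded_martingales"
  unfolding bounded_martingales_def
proof (intro CollectI conjI allI ballI)
  fix n
  show c: "components v n \<in> vcarrier (L n)" for n
    by (simp add: components_def I.adj_closed v)
  show "vinner K (i n x) (i (Suc n) (components v (Suc n))) = vinner (L n) x (components v n)"
    if x: "x \<in> vcarrier (L n)" for x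
  proof -
    obtain y where y: "y \<in> vcarrier (L (Suc n))" "i n x = i (Suc n) y" using increasing x by blast
    then show ?thesis using c[of "Suc n"] x v
      by (simp add: I.inner) (simp add: components_def I.inner_adj flip: y(2))
  qed
  have "Re (vinner (L n) (components v n) (components v n)) \<le> Re (vinner K v v)" for n
  proof -
    have ic: "i n (components v n) \<in> vcarrier K" using I.closed c by blast
    have "vinner (L n) (components v n) (components v n) = vinner K (i n (components v n)) v"
      using I.inner_adj[OF v c[of n]] by (simp add: components_def)
    \<comment> \<open>With the identity just shown, expanding this square gives Bessel's inequality
      for the projection of \<open>v\<close>.\<close>
    moreover have "0 \<le> (vnorm K (vdiff K (i n (components v n)) v))\<^sup>2" by simp
    ultimately show ?thesis
      by (simp add: K.norm_diff_square ic v I.inner c)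
  qed
  then show "bdd_above (range (\<lambda>n. Re (vinner (L n) (components v n) (components v n))))"
    by (auto intro!: bdd_aboveI)
qed

lemma components_inject:
  assumes v: "v \<in> vcarrier K" "w \<in> vcarrier K" and eq: "components v = components w"
  shows "v = w"
proof -
  have "vinner K (i n x) (vdiff K v w) = 0" if "x \<in> vcarrier (L n)" for n x
    using that v fun_cong[OF eq, of n] I.inner_adj[OF v(1) that] I.inner_adj[OF v(2) that]
    by (simp add: K.inner_diff_right I.closed components_def)
  then have "vdiff K v w = vzero K" by (intro total) (auto simp: K.diff_closed v)
  then show ?thesis using v K.diff_eq_zeroD by blast
qed

text \<open>The martingale of \<open>v\<close> converges to some vector with the same components;
  injectivity, that is totality, forces this vector to be \<open>v\<close>.\<close>

lemma components_tendsto: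
  assumes v: "v \<in> vcarrier K"
  shows "(\<lambda>n. vnorm K (vdiff K (i n (components v n)) v)) \<longlonglongrightarrow> 0"
  using components_martingale[OF v] martingale_limit components_inject[OF v] by metis

lemma bij_components: "bij_betw components (vcarrier K) bounded_martingales"
  unfolding bij_betw_def
proof (intro conjI inj_onI equalityI subsetI)
  show "\<Xi> \<in> components ` vcarrier K" if "\<Xi> \<in> bounded_martingales" for \<Xi>
    using martingale_limit[OF that] by blast
qed (use components_inject components_martingale in auto)

lemma components_inner_tendsto:
  assumes v: "v \<in> vcarrier K" "w \<in> vcarrier K"
  shows "(\<lambda>n. vinner (L n) (components v n) (components w n)) \<longlonglongrightarrow> vinner K v w"
proof -
  have c: "components u n \<in> vcarrier (L n)" if "u \<in> vcarrier K" for u n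
    using that by (simp add: components_def I.adj_closed)
  have "(\<lambda>n. vinner K (i n (components v n)) (i n (components w n))) \<longlonglongrightarrow> vinner K v w"
    by (intro K.tendsto_inner components_tendsto I.closed c v)
  then show ?thesis by (simp add: I.inner c v)
qed

text \<open>Linearity follows from \<open>adj_unique\<close>, preservation of inner products from
  the convergence of the components, and the Hilbert space axioms for \<open>S\<close> by
  transport.\<close>

theorem hilbert_space_isomorphism_components:
  assumes carrier: "vcarrier S = bounded_martingales"
    and add: "\<And>\<Xi> \<Psi>. vadd S \<Xi> \<Psi> = (\<lambda>n. vadd (L n) (\<Xi> n) (\<Psi> n))"
    and zero: "vzero S = (\<lambda>n. vzero (L n))"
    and scale: "\<And>c \<Xi>. vscale S c \<Xi> = (\<lambda>n. vscale (L n) c (\<Xi> n))"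
    and inner: "\<And>\<Xi> \<Psi>. \<Xi> \<in> vcarrier S \<Longrightarrow> \<Psi> \<in> vcarrier S \<Longrightarrow>
      vinner S \<Xi> \<Psi> = lim (\<lambda>n. vinner (L n) (\<Xi> n) (\<Psi> n))"
  shows "hilbert_space_isomorphism K S components"
proof -
  have c: "components u n \<in> vcarrier (L n)" if "u \<in> vcarrier K" for u n
    using that by (simp add: components_def I.adj_closed)
  have bij: "bij_betw components (vcarrier K) (vcarrier S)" by (simp add: carrier bij_components)
  have z: "components (vzero K) = vzero S"
    unfolding zero components_def
    by (intro ext I.adj_unique)
      (auto simp: K.zero_closed I.L.zero_closed I.L.inner_zero_right K.inner_zero_right I.closed)
  have a: "components (vadd K u v) = vadd S (components u) (components v)"
    if "u \<in> vcarrier K" "v \<in> vcarrier K" for u v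
    unfolding add components_def using that
    by (intro ext I.adj_unique)
      (auto simp: K.add_closed I.L.add_closed I.adj_closed I.L.inner_add_right
        K.inner_add_right I.closed I.inner_adj)
  have s: "components (vscale K b u) = vscale S b (components u)" if "u \<in> vcarrier K" for b u
    unfolding scale components_def using that
    by (intro ext I.adj_unique)
      (auto simp: K.scale_closed I.L.scale_closed I.adj_closed I.L.inner_scale_right
        K.inner_scale_right I.closed I.inner_adj)
  have i: "vinner S (components u) (components v) = vinner K u v"
    if "u \<in> vcarrier K" "v \<in> vcarrier K" for u v
    using that components_inner_tendsto[OF that]
    by (subst inner) (auto simp: carrier components_martingale limI)
  show ?thesis
    unfolding hilbert_space_isomorphism_def
    using complex_hilbert_space_transport[OF K.complex_hilbert_space_axioms bij z a s i]
      K.complex_hilbert_space_axioms bij a s i by auto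
qed

end

section \<open>The space of square integrable functions\<close>

lemma square_integrable_add:
  assumes "f \<in> square_integrable M" "g \<in> square_integrable M"
  shows "(\<lambda>x. f x + g x) \<in> square_integrable M"
proof -
  have "integrable M (\<lambda>x. (cmod (f x + g x))\<^sup>2)"
  proof (rule Bochner_Integration.integrable_bound)
    show "integrable M (\<lambda>x. 2 * (cmod (f x))\<^sup>2 + 2 * (cmod (g x))\<^sup>2)"
      using assms by (auto simp: square_integrable_def)
    have "(cmod (f x + g x))\<^sup>2 \<le> 2 * (cmod (f x))\<^sup>2 + 2 * (cmod (g x))\<^sup>2" for x
    proof -
      have "(cmod (f x + g x))\<^sup>2 \<le> (cmod (f x) + cmod (g x))\<^sup>2"
        by (intro power_mono norm_triangle_ineq) auto
      also have "\<dots> \<le> 2 * (cmod (f x))\<^sup>2 + 2 * (cmod (g x))\<^sup>2"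
        using sum_squares_bound[of "cmod (f x)" "cmod (g x)"] by (simp add: power2_sum)
      finally show ?thesis .
    qed
    then show "AE x in M. norm ((cmod (f x + g x))\<^sup>2)
        \<le> norm (2 * (cmod (f x))\<^sup>2 + 2 * (cmod (g x))\<^sup>2)" by auto
  qed (use assms in \<open>auto simp: square_integrable_def\<close>)
  then show ?thesis using assms by (auto simp: square_integrable_def)
qed

lemma square_integrable_scale:
  "f \<in> square_integrable M \<Longrightarrow> (\<lambda>x. c * f x) \<in> square_integrable M"
  by (auto simp: square_integrable_def norm_mult power_mult_distrib)

lemma square_integrable_diff:
  assumes "f \<in> square_integrable M" "g \<in> square_integrable M"
  shows "(\<lambda>x. f x - g x) \<in> square_integrable M"
  using square_integrable_add[OF assms(1) square_integrable_scale[OF assms(2), of "-1"]] by simp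

lemma square_integrable_zero: "(\<lambda>x. 0) \<in> square_integrable M"
  by (simp add: square_integrable_def)

lemma borel_measurable_cnj [measurable (raw)]:
  "f \<in> borel_measurable M \<Longrightarrow> (\<lambda>x. cnj (f x)) \<in> borel_measurable M"
  by (rule measurable_compose[OF _ borel_measurable_continuous_onI[OF continuous_on_cnj]])
    (auto intro: continuous_on_id)

lemma integrable_cnj_mult:
  assumes "f \<in> square_integrable M" "g \<in> square_integrable M"
  shows "integrable M (\<lambda>x. cnj (f x) * g x)"
proof (rule Bochner_Integration.integrable_bound)
  show "integrable M (\<lambda>x. (cmod (f x))\<^sup>2 + (cmod (g x))\<^sup>2)"
    using assms by (auto simp: square_integrable_def)
  have "cmod (f x) * cmod (g x) \<le> (cmod (f x))\<^sup>2 + (cmod (g x))\<^sup>2" for x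
    using sum_squares_bound[of "cmod (f x)" "cmod (g x)"]
      mult_nonneg_nonneg[OF norm_ge_zero[of "f x"] norm_ge_zero[of "g x"]] by linarith
  then show "AE x in M. norm (cnj (f x) * g x) \<le> norm ((cmod (f x))\<^sup>2 + (cmod (g x))\<^sup>2)"
    by (auto simp: norm_mult)
qed (use assms in \<open>auto simp: square_integrable_def\<close>)

lemma equiv_ae_rel: "equiv (square_integrable M) (ae_rel M)"
proof (rule equivI)
  show "refl_on (square_integrable M) (ae_rel M)"
    by (auto simp: refl_on_def ae_rel_def)
  show "sym (ae_rel M)" by (auto simp: sym_def ae_rel_def elim: eventually_mono)
  show "trans (ae_rel M)"
    by (rule transI) (auto simp: ae_rel_def elim: eventually_elim2)
  show "ae_rel M \<subseteq> square_integrable M \<times> square_integrable M" by (auto simp: ae_rel_def)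
qed

lemma L2_carrierI: "f \<in> square_integrable M \<Longrightarrow> ae_class M f \<in> vcarrier (L2 M)"
  by (auto simp: L2_def ae_class_def quotientI)

lemma L2_carrierE:
  assumes "F \<in> vcarrier (L2 M)"
  obtains f where "f \<in> square_integrable M" "F = ae_class M f"
  using assms by (auto simp: L2_def ae_class_def elim: quotientE)

lemma ae_class_eq_iff:
  assumes "f \<in> square_integrable M" "g \<in> square_integrable M"
  shows "ae_class M f = ae_class M g \<longleftrightarrow> (AE x in M. f x = g x)"
  using eq_equiv_class_iff[OF equiv_ae_rel assms] assms
  by (auto simp: ae_class_def ae_rel_def)

lemma rep_ae_class:
  assumes "f \<in> square_integrable M"
  shows "rep (ae_class M f) \<in> square_integrable M" "AE x in M. rep (ae_class M f) x = f x"
proof -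
  have "f \<in> ae_class M f"
    using equiv_class_self[OF equiv_ae_rel assms] by (simp add: ae_class_def)
  then have "rep (ae_class M f) \<in> ae_class M f" unfolding rep_def
    by (rule someI[where P = "\<lambda>g. g \<in> ae_class M f"])
  then show "rep (ae_class M f) \<in> square_integrable M" "AE x in M. rep (ae_class M f) x = f x"
    by (auto simp: ae_class_def ae_rel_def elim: eventually_mono)
qed

lemma L2_rep:
  assumes "F \<in> vcarrier (L2 M)"
  shows "rep F \<in> square_integrable M" "ae_class M (rep F) = F"
proof -
  obtain f where f: "f \<in> square_integrable M" "F = ae_class M f" using assms by (rule L2_carrierE)
  then show "rep F \<in> square_integrable M" using rep_ae_class by blast
  then show "ae_class M (rep F) = F" using f rep_ae_class ae_class_eq_iff by metis
qed

lemma L2_vzero: "vzero (L2 M) = ae_class M (\<lambda>x. 0)"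
  by (simp add: L2_def)

lemma L2_vadd:
  assumes "f \<in> square_integrable M" "g \<in> square_integrable M"
  shows "vadd (L2 M) (ae_class M f) (ae_class M g) = ae_class M (\<lambda>x. f x + g x)"
proof -
  have "AE x in M. rep (ae_class M f) x + rep (ae_class M g) x = f x + g x"
    using rep_ae_class(2)[OF assms(1)] rep_ae_class(2)[OF assms(2)] by eventually_elim simp
  then show ?thesis
    by (simp add: L2_def ae_class_eq_iff square_integrable_add rep_ae_class assms)
qed

lemma L2_vscale:
  assumes "f \<in> square_integrable M"
  shows "vscale (L2 M) c (ae_class M f) = ae_class M (\<lambda>x. c * f x)"
proof -
  have "AE x in M. c * rep (ae_class M f) x = c * f x"
    using rep_ae_class(2)[OF assms(1)] by eventually_elim simp
  then show ?thesis
    unfolding L2_def by (simp add: ae_class_eq_iff square_integrable_scale rep_ae_class assms del: mult_cancel_left)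
qed

lemma L2_vdiff:
  assumes "f \<in> square_integrable M" "g \<in> square_integrable M"
  shows "vdiff (L2 M) (ae_class M f) (ae_class M g) = ae_class M (\<lambda>x. f x - g x)"
  using L2_vadd[OF assms(1) square_integrable_scale[OF assms(2), of "-1"]]
  by (simp add: vdiff_def L2_vscale assms)

lemma L2_vinner_rep: "vinner (L2 M) F G = (\<integral>x. cnj (rep F x) * rep G x \<partial>M)"
  by (simp add: L2_def)

lemma L2_vinner:
  assumes "f \<in> square_integrable M" "g \<in> square_integrable M"
  shows "vinner (L2 M) (ae_class M f) (ae_class M g) = (\<integral>x. cnj (f x) * g x \<partial>M)"
  unfolding L2_vinner_rep
proof (rule integral_cong_AE)
  show "AE x in M. cnj (rep (ae_class M f) x) * rep (ae_class M g) x = cnj (f x) * g x"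
    using rep_ae_class(2)[OF assms(1)] rep_ae_class(2)[OF assms(2)] by eventually_elim simp
qed (use assms integrable_cnj_mult rep_ae_class(1) borel_measurable_integrable in blast)+

lemma L2_vinner_self:
  assumes "f \<in> square_integrable M"
  shows "vinner (L2 M) (ae_class M f) (ae_class M f) = of_real (\<integral>x. (cmod (f x))\<^sup>2 \<partial>M)"
  by (simp add: L2_vinner assms mult.commute[of "cnj _"] complex_norm_square[symmetric]
      del: of_real_power)

lemma nn_integral_square_integrable:
  "f \<in> square_integrable M \<Longrightarrow>
    (\<integral>\<^sup>+x. ennreal ((cmod (f x))\<^sup>2) \<partial>M) = ennreal (\<integral>x. (cmod (f x))\<^sup>2 \<partial>M)"
  by (intro nn_integral_eq_integral) (auto simp: square_integrable_def)

text \<open>Either |d_j| is at most 2^(-j), or 2^j |d_j| exceeds 1 and then |d_j| is at most 2^j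
  |d_j|^2; the sum of both bounds is summable.\<close>

lemma summable_norm_of_weighted_squares:
  fixes d :: "nat \<Rightarrow> 'b::banach"
  assumes "summable (\<lambda>j. 2 ^ j * (norm (d j))\<^sup>2)"
  shows "summable d"
proof (rule summable_comparison_test)
  show "summable (\<lambda>j. (1/2) ^ j + 2 ^ j * (norm (d j))\<^sup>2 :: real)"
    using assms by (intro summable_add summable_geometric) auto
  have "norm (d j) \<le> (1/2) ^ j + 2 ^ j * (norm (d j))\<^sup>2" for j
  proof (cases "norm (d j) \<le> (1/2) ^ j")
    case False
    then have "1 \<le> 2 ^ j * norm (d j)" by (simp add: power_one_over field_simps)
    then have "1 * norm (d j) \<le> (2 ^ j * norm (d j)) * norm (d j)"
      by (intro mult_right_mono) auto
    then show ?thesis by (simp add: power2_eq_square mult.assoc add_increasing)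
  qed (simp add: add_increasing2)
  then show "\<exists>N. \<forall>n\<ge>N. norm (d n) \<le> (1/2) ^ n + 2 ^ n * (norm (d n))\<^sup>2" by blast
qed

text \<open>Riesz-Fischer: a fast subsequence converges almost everywhere, and Fatou's lemma turns
  its limit into the limit in mean square.\<close>

lemma square_integrable_complete:
  fixes f :: "nat \<Rightarrow> 'a \<Rightarrow> complex"
  assumes f: "\<And>n. f n \<in> square_integrable M"
    and cauchy: "\<And>e. e > 0 \<Longrightarrow> \<exists>N. \<forall>m\<ge>N. \<forall>n\<ge>N. (\<integral>x. (cmod (f m x - f n x))\<^sup>2 \<partial>M) < e"
  obtains g where "g \<in> square_integrable M" "(\<lambda>n. \<integral>x. (cmod (f n x - g x))\<^sup>2 \<partial>M) \<longlonglongrightarrow> 0"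
proof -
  have [measurable]: "f n \<in> borel_measurable M" for n
    using f by (auto simp: square_integrable_def)
  \<comment> \<open>The rate (1/4)^j leaves the summable (1/2)^j after multiplication with the
    weight 2^j.\<close>
  have "\<forall>j. \<exists>N. \<forall>m\<ge>N. \<forall>n\<ge>N. (\<integral>x. (cmod (f m x - f n x))\<^sup>2 \<partial>M) < (1/4) ^ j"
    using cauchy by simp
  then obtain N where N: "\<And>j m n. m \<ge> N j \<Longrightarrow> n \<ge> N j \<Longrightarrow>
      (\<integral>x. (cmod (f m x - f n x))\<^sup>2 \<partial>M) < (1/4) ^ j"
    by metis
  \<comment> \<open>Partial sums dominate each \<open>N j\<close>, and the added 1 makes the index
    strictly increasing.\<close>
  define k where "k j = (\<Sum>i\<le>j. N i + 1)" for j
  have kN: "k j \<ge> N j" for j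
    unfolding k_def using member_le_sum[of j "{..j}" "\<lambda>i. N i + 1"] by simp
  have kSuc: "k (Suc j) > k j" for j by (simp add: k_def)
  then have k: "strict_mono k" by (simp add: strict_mono_Suc_iff)
  define d where "d j x = f (k (Suc j)) x - f (k j) x" for j x
  have d_meas[measurable]: "d j \<in> borel_measurable M" for j unfolding d_def by measurable
  have d_sq: "d j \<in> square_integrable M" for j
    unfolding d_def by (intro square_integrable_diff f)
  have d_int: "(\<integral>\<^sup>+x. ennreal (2 ^ j * (cmod (d j x))\<^sup>2) \<partial>M) \<le> ennreal ((1/2) ^ j)" for j
  proof -
    have "(\<integral>\<^sup>+x. ennreal (2 ^ j * (cmod (d j x))\<^sup>2) \<partial>M)
        = ennreal (2 ^ j) * (\<integral>\<^sup>+x. ennreal ((cmod (d j x))\<^sup>2) \<partial>M)"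
      by (subst nn_integral_cmult[symmetric]) (auto simp: ennreal_mult)
    also have "\<dots> = ennreal (2 ^ j * (\<integral>x. (cmod (d j x))\<^sup>2 \<partial>M))"
      by (simp add: nn_integral_square_integrable d_sq ennreal_mult del: ennreal_power)
    also have "\<dots> \<le> ennreal (2 ^ j * (1/4) ^ j)"
      using N[of j "k (Suc j)" "k j"] kN[of j] kSuc[of j]
      by (intro ennreal_leI mult_left_mono) (auto simp: d_def)
    also have "2 ^ j * (1/4) ^ j = ((1/2) ^ j :: real)"
      by (simp flip: power_mult_distrib)
    finally show ?thesis .
  qed
  have "(\<integral>\<^sup>+x. (\<Sum>j. ennreal (2 ^ j * (cmod (d j x))\<^sup>2)) \<partial>M)
      = (\<Sum>j. \<integral>\<^sup>+x. ennreal (2 ^ j * (cmod (d j x))\<^sup>2) \<partial>M)"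
    by (rule nn_integral_suminf) simp
  also have "\<dots> \<le> (\<Sum>j. ennreal ((1/2) ^ j))"
    by (intro suminf_le d_int) auto
  also have "\<dots> = ennreal (\<Sum>j. (1/2) ^ j)"
    by (rule suminf_ennreal2) (auto intro: summable_geometric)
  also have "\<dots> < \<infinity>" by simp
  finally have fin: "(\<integral>\<^sup>+x. (\<Sum>j. ennreal (2 ^ j * (cmod (d j x))\<^sup>2)) \<partial>M) \<noteq> \<infinity>" by simp
  have "AE x in M. (\<Sum>j. ennreal (2 ^ j * (cmod (d j x))\<^sup>2)) \<noteq> \<infinity>"
    by (rule nn_integral_PInf_AE[OF _ fin]) simp
  then have conv: "AE x in M. convergent (\<lambda>j. f (k j) x)"
  proof eventually_elim
    case (elim x)
    then have "summable (\<lambda>j. 2 ^ j * (cmod (d j x))\<^sup>2)"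
      by (intro summable_suminf_not_top) (auto simp: top_ennreal_def)
    then have "summable (\<lambda>j. d j x)" by (rule summable_norm_of_weighted_squares)
    then have "convergent (\<lambda>n. \<Sum>j<n. d j x)" by (simp add: summable_iff_convergent)
    moreover have "(\<Sum>j<n. d j x) = f (k n) x - f (k 0) x" for n
      unfolding d_def by (rule sum_lessThan_telescope)
    ultimately show "convergent (\<lambda>j. f (k j) x)"
      using convergent_add[of "\<lambda>n. f (k n) x - f (k 0) x" "\<lambda>n. f (k 0) x"]
      by (simp add: convergent_const)
  qed
  define g where "g x = lim (\<lambda>j. f (k j) x)" for x
  have g_meas[measurable]: "g \<in> borel_measurable M"
    unfolding g_def by (rule borel_measurable_lim_metric) simp
  \<comment> \<open>Fatou's lemma along the subsequence. Nonnegative integrals are used because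
    integrability of the squared difference is itself still to be derived.\<close>
  have bound: "(\<integral>\<^sup>+x. ennreal ((cmod (f n x - g x))\<^sup>2) \<partial>M) \<le> ennreal e"
    if e: "\<And>j. k j \<ge> K \<Longrightarrow> (\<integral>x. (cmod (f n x - f (k j) x))\<^sup>2 \<partial>M) \<le> e" for n e K
  proof -
    have "(\<integral>\<^sup>+x. ennreal ((cmod (f n x - g x))\<^sup>2) \<partial>M)
        = (\<integral>\<^sup>+x. liminf (\<lambda>j. ennreal ((cmod (f n x - f (k j) x))\<^sup>2)) \<partial>M)"
    proof (rule nn_integral_cong_AE, use conv in eventually_elim)
      fix x assume "convergent (\<lambda>j. f (k j) x)"
      then have "(\<lambda>j. f (k j) x) \<longlonglongrightarrow> g x" by (simp add: g_def convergent_LIMSEQ_iff)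
      then have "(\<lambda>j. ennreal ((cmod (f n x - f (k j) x))\<^sup>2)) \<longlonglongrightarrow> ennreal ((cmod (f n x - g x))\<^sup>2)"
        by (intro tendsto_intros)
      then show "ennreal ((cmod (f n x - g x))\<^sup>2)
          = liminf (\<lambda>j. ennreal ((cmod (f n x - f (k j) x))\<^sup>2))"
        by (rule lim_imp_Liminf[OF sequentially_bot, symmetric])
    qed
    also have "\<dots> \<le> liminf (\<lambda>j. \<integral>\<^sup>+x. ennreal ((cmod (f n x - f (k j) x))\<^sup>2) \<partial>M)"
      by (rule nn_integral_liminf) simp
    also have "\<dots> \<le> ennreal e"
    proof (rule Liminf_le)
      have "\<forall>\<^sub>F j in sequentially. k j \<ge> K"
        using k by (meson eventually_sequentiallyI le_trans seq_suble)
      then show "\<forall>\<^sub>F j in sequentially.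
          (\<integral>\<^sup>+x. ennreal ((cmod (f n x - f (k j) x))\<^sup>2) \<partial>M) \<le> ennreal e"
        by eventually_elim
          (subst nn_integral_square_integrable, auto intro!: square_integrable_diff f ennreal_leI e)
    qed simp
    finally show ?thesis .
  qed
  \<comment> \<open>The rate at j = 0 is (1/4)^0 = 1, so \<open>N 0\<close> already gives a finite
    bound.\<close>
  have diff_sq: "(\<lambda>x. f n x - g x) \<in> square_integrable M" if "n \<ge> N 0" for n
  proof -
    have "(\<integral>\<^sup>+x. ennreal ((cmod (f n x - g x))\<^sup>2) \<partial>M) \<le> ennreal 1"
      by (rule bound[of "N 0"]) (use N[of 0 n] that in \<open>auto intro: less_imp_le\<close>)
    then show ?thesis
      by (auto simp: square_integrable_def integrable_iff_bounded
          intro: le_less_trans)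
  qed
  show ?thesis
  proof
    show "g \<in> square_integrable M"
      using square_integrable_diff[OF f[of "N 0"] diff_sq[of "N 0"]] by simp
    show "(\<lambda>n. \<integral>x. (cmod (f n x - g x))\<^sup>2 \<partial>M) \<longlonglongrightarrow> 0"
    proof (rule LIMSEQ_I)
      fix e :: real assume "e > 0"
      then obtain K where K: "\<And>m n. m \<ge> K \<Longrightarrow> n \<ge> K \<Longrightarrow> (\<integral>x. (cmod (f m x - f n x))\<^sup>2 \<partial>M) < e/2"
        using cauchy[of "e/2"] by auto
      have "(\<integral>x. (cmod (f n x - g x))\<^sup>2 \<partial>M) < e" if "n \<ge> max K (N 0)" for n
      proof -
        have "(\<integral>\<^sup>+x. ennreal ((cmod (f n x - g x))\<^sup>2) \<partial>M) \<le> ennreal (e/2)"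
          by (rule bound[of K]) (use K[of n] that in \<open>auto intro: less_imp_le\<close>)
        then have "(\<integral>x. (cmod (f n x - g x))\<^sup>2 \<partial>M) \<le> e/2"
          using that \<open>e > 0\<close> by (subst (asm) nn_integral_square_integrable) (auto intro: diff_sq)
        then show ?thesis using \<open>e > 0\<close> by simp
      qed
      then show "\<exists>no. \<forall>n\<ge>no. norm ((\<integral>x. (cmod (f n x - g x))\<^sup>2 \<partial>M) - 0) < e"
        by (intro exI[of _ "max K (N 0)"]) auto
    qed
  qed
qed

lemma complex_hilbert_space_L2: "complex_hilbert_space (L2 M)"
proof
  note rules = square_integrable_add square_integrable_scale square_integrable_zero
    square_integrable_diff
  note simps = L2_vzero L2_vadd L2_vscale L2_vdiff L2_vinner rules
  show "vzero (L2 M) \<in> vcarrier (L2 M)"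
    by (auto simp: L2_vzero intro: L2_carrierI rules)
  fix u v w :: "('a \<Rightarrow> complex) set" and c d :: complex
  show "vinner (L2 M) u v = cnj (vinner (L2 M) v u)"
    unfolding L2_vinner_rep by (simp add: mult.commute flip: Bochner_Integration.integral_cnj)
  assume u: "u \<in> vcarrier (L2 M)"
  show "vscale (L2 M) c u \<in> vcarrier (L2 M)"
    using u by (elim L2_carrierE) (auto simp: simps intro: L2_carrierI rules)
  show "vadd (L2 M) u (vzero (L2 M)) = u" "vdiff (L2 M) u u = vzero (L2 M)"
    "vscale (L2 M) 1 u = u"
    "vscale (L2 M) (c + d) u = vadd (L2 M) (vscale (L2 M) c u) (vscale (L2 M) d u)"
    "vscale (L2 M) c (vscale (L2 M) d u) = vscale (L2 M) (c * d) u"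
    using u by (elim L2_carrierE; simp add: simps algebra_simps)+
  show "0 \<le> Re (vinner (L2 M) u u)"
    using u by (elim L2_carrierE) (simp add: L2_vinner_self)
  show "u = vzero (L2 M)" if "vinner (L2 M) u u = 0"
  proof -
    obtain f where f: "f \<in> square_integrable M" "u = ae_class M f" using u by (rule L2_carrierE)
    then have "(\<integral>x. (cmod (f x))\<^sup>2 \<partial>M) = 0" using that by (simp add: L2_vinner_self)
    then have "AE x in M. f x = 0"
      using f by (subst (asm) integral_nonneg_eq_0_iff_AE) (auto simp: square_integrable_def)
    then show ?thesis using f by (simp add: L2_vzero ae_class_eq_iff rules)
  qed
  assume v: "v \<in> vcarrier (L2 M)"
  show "vadd (L2 M) u v \<in> vcarrier (L2 M)"
    using u v by (elim L2_carrierE) (auto simp: simps intro: L2_carrierI rules)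
  show "vadd (L2 M) u v = vadd (L2 M) v u"
    "vscale (L2 M) c (vadd (L2 M) u v) = vadd (L2 M) (vscale (L2 M) c u) (vscale (L2 M) c v)"
    using u v by (elim L2_carrierE; simp add: simps algebra_simps)+
  show "vinner (L2 M) u (vscale (L2 M) c v) = c * vinner (L2 M) u v"
    using u v by (elim L2_carrierE) (simp add: simps mult.left_commute)
  assume w: "w \<in> vcarrier (L2 M)"
  show "vadd (L2 M) (vadd (L2 M) u v) w = vadd (L2 M) u (vadd (L2 M) v w)"
    using u v w by (elim L2_carrierE) (simp add: simps add.assoc)
  show "vinner (L2 M) u (vadd (L2 M) v w) = vinner (L2 M) u v + vinner (L2 M) u w"
    using u v w by (elim L2_carrierE) (simp add: simps distrib_left integrable_cnj_mult)
next
  fix s :: "nat \<Rightarrow> _" assume s: "\<And>n. s n \<in> vcarrier (L2 M)"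
    and cauchy: "\<forall>e>0. \<exists>N. \<forall>m\<ge>N. \<forall>n\<ge>N. vnorm (L2 M) (vdiff (L2 M) (s m) (s n)) < e"
  define f where "f n = rep (s n)" for n
  have f: "f n \<in> square_integrable M" "s n = ae_class M (f n)" for n
    using L2_rep[OF s, of n] by (auto simp: f_def)
  have norm: "vnorm (L2 M) (vdiff (L2 M) (s n) (ae_class M g)) = sqrt (\<integral>x. (cmod (f n x - g x))\<^sup>2 \<partial>M)"
    if "g \<in> square_integrable M" for n g
    by (simp add: vnorm_def f that L2_vdiff L2_vinner_self square_integrable_diff)
  have "\<exists>N. \<forall>m\<ge>N. \<forall>n\<ge>N. (\<integral>x. (cmod (f m x - f n x))\<^sup>2 \<partial>M) < e" if "e > 0" for e
  proof -
    have "\<exists>N. \<forall>m\<ge>N. \<forall>n\<ge>N. vnorm (L2 M) (vdiff (L2 M) (s m) (ae_class M (f n))) < sqrt e"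
      using cauchy that unfolding f(2)[symmetric] by simp
    then show ?thesis by (simp add: norm f(1))
  qed
  with f(1) obtain g where g: "g \<in> square_integrable M"
    "(\<lambda>n. \<integral>x. (cmod (f n x - g x))\<^sup>2 \<partial>M) \<longlonglongrightarrow> 0"
    by (rule square_integrable_complete[of f M]) auto
  show "\<exists>l\<in>vcarrier (L2 M). (\<lambda>n. vnorm (L2 M) (vdiff (L2 M) (s n) l)) \<longlonglongrightarrow> 0"
  proof
    show "(\<lambda>n. vnorm (L2 M) (vdiff (L2 M) (s n) (ae_class M g))) \<longlonglongrightarrow> 0"
      using tendsto_real_sqrt[OF g(2)] by (simp add: norm g)
  qed (use g in \<open>simp add: L2_carrierI\<close>)
qed

section \<open>Averages over fibres\<close>

text \<open>The transfer operator for \<open>m0 = 1\<close>. Strong invariance is a statement about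
  it alone; the factors from \<open>m0\<close> are collected separately in
  \<open>weight\<close>.\<close>

definition fibre_avg :: "('a \<Rightarrow> 'a) \<Rightarrow> ('a \<Rightarrow> 'b::real_normed_field) \<Rightarrow> 'a \<Rightarrow> 'b" where
  "fibre_avg r f x = 1 / of_nat (card (r -` {x})) * (\<Sum>y\<in>r -` {x}. f y)"

definition weight :: "('a \<Rightarrow> 'a) \<Rightarrow> ('a \<Rightarrow> complex) \<Rightarrow> nat \<Rightarrow> 'a \<Rightarrow> real" where
  "weight r m0 n x = (\<Prod>k<n. (cmod (m0 ((r ^^ k) x)))\<^sup>2)"

lemma weight_nonneg: "weight r m0 n x \<ge> 0"
  by (simp add: weight_def prod_nonneg)

lemma weight_0 [simp]: "weight r m0 0 x = 1"
  by (simp add: weight_def)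

lemma weight_Suc: "weight r m0 (Suc n) x = weight r m0 n x * (cmod (m0 ((r ^^ n) x)))\<^sup>2"
  by (simp add: weight_def)

text \<open>Splits off the first factor instead of the last: the remaining factor depends on
  \<open>r x\<close> only, hence is constant on fibres and leaves a single average.\<close>

lemma weight_Suc_shift: "weight r m0 (Suc n) x = (cmod (m0 x))\<^sup>2 * weight r m0 n (r x)"
  unfolding weight_def by (subst prod.lessThan_Suc_shift) (simp add: funpow_swap1)

lemma transfer_op_eq_fibre_avg:
  "transfer_op r m0 f = fibre_avg r (\<lambda>y. of_real ((cmod (m0 y))\<^sup>2) * f y)"
  by (simp add: transfer_op_def fibre_avg_def fun_eq_iff)

text \<open>A function of \<open>r y\<close> is constant on the fibre. This is the module property
  of a conditional expectation.\<close>

lemma fibre_avg_pull_out: "fibre_avg r (\<lambda>y. g (r y) * f y) x = g x * fibre_avg r f x"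
proof -
  have "(\<Sum>y\<in>r -` {x}. g (r y) * f y) = (\<Sum>y\<in>r -` {x}. g x * f y)"
    by (rule sum.cong) auto
  then show ?thesis by (simp add: fibre_avg_def sum_distrib_left[symmetric] mult.left_commute)
qed

lemma fibre_avg_pow_pull_out:
  "(fibre_avg r ^^ n) (\<lambda>y. g ((r ^^ n) y) * f y) = (\<lambda>x. g x * (fibre_avg r ^^ n) f x)"
proof (induction n arbitrary: g)
  case (Suc n)
  have "(fibre_avg r ^^ Suc n) (\<lambda>y. g ((r ^^ Suc n) y) * f y)
      = fibre_avg r ((fibre_avg r ^^ n) (\<lambda>y. (g \<circ> r) ((r ^^ n) y) * f y))" by simp
  also have "\<dots> = fibre_avg r (\<lambda>x. g (r x) * (fibre_avg r ^^ n) f x)"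
    by (subst Suc.IH) simp
  also have "\<dots> = (\<lambda>x. g x * (fibre_avg r ^^ Suc n) f x)"
    by (simp add: fibre_avg_pull_out fun_eq_iff)
  finally show ?case .
qed simp

text \<open>A new factor |m0|^2 stands outside \<open>n\<close> averages; moving it inside composes
  it with r^n, which is the next factor of the weight.\<close>

lemma transfer_op_pow:
  fixes f :: "'a \<Rightarrow> 'b::real_normed_field"
  shows "(transfer_op r m0 ^^ n) f = (fibre_avg r ^^ n) (\<lambda>y. of_real (weight r m0 n y) * f y)"
proof (induction n)
  case (Suc n)
  have "(transfer_op r m0 ^^ Suc n) f
      = fibre_avg r (\<lambda>y. of_real ((cmod (m0 y))\<^sup>2) * (fibre_avg r ^^ n) (\<lambda>y. of_real (weight r m0 n y) * f y) y)"
    by (simp add: Suc.IH transfer_op_eq_fibre_avg)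
  also have "\<dots> = fibre_avg r ((fibre_avg r ^^ n)
      (\<lambda>y. of_real ((cmod (m0 ((r ^^ n) y)))\<^sup>2) * (of_real (weight r m0 n y) * f y)))"
    by (subst fibre_avg_pow_pull_out[where g = "\<lambda>y. of_real ((cmod (m0 y))\<^sup>2)"]) simp
  finally show ?case by (simp add: weight_Suc mult_ac)
qed simp

lemma fibre_avg_of_real: "fibre_avg r (\<lambda>y. of_real (f y)) = (\<lambda>x. of_real (fibre_avg r f x))"
  by (simp add: fibre_avg_def fun_eq_iff)

lemma fibre_avg_mono:
  fixes f g :: "'a \<Rightarrow> real"
  assumes "\<And>y. f y \<le> g y"
  shows "fibre_avg r f x \<le> fibre_avg r g x"
  unfolding fibre_avg_def by (intro mult_left_mono sum_mono assms) auto

lemma fibre_avg_nonneg: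
  fixes f :: "'a \<Rightarrow> real"
  assumes "\<And>y. f y \<ge> 0"
  shows "fibre_avg r f x \<ge> 0"
  unfolding fibre_avg_def by (intro mult_nonneg_nonneg sum_nonneg assms) auto

lemma norm_fibre_avg_le: "norm (fibre_avg r f x) \<le> fibre_avg r (\<lambda>y. norm (f y)) x"
  by (auto simp: fibre_avg_def norm_mult norm_divide intro!: mult_left_mono divide_right_mono norm_sum)

lemma fibre_avg_tendsto:
  assumes "\<And>y. (\<lambda>n. f n y) \<longlonglongrightarrow> g y"
  shows "(\<lambda>n. fibre_avg r (f n) x) \<longlonglongrightarrow> fibre_avg r g x"
  unfolding fibre_avg_def by (intro tendsto_intros assms)

section \<open>Consequences of strong invariance\<close>

locale invariant_system = prob_space \<mu>
  for \<mu> :: "'a::topological_space measure" +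
  fixes r :: "'a \<Rightarrow> 'a"
  assumes r_measurable [measurable]: "r \<in> borel \<rightarrow>\<^sub>M borel"
    and surj_r: "surj r" and finite_fibre: "finite (r -` {x})"
    and sets_mu [measurable_cong, simp]: "sets \<mu> = sets borel"
    and invariant: "strongly_invariant r \<mu>"
begin

lemma space_mu [simp]: "space \<mu> = UNIV"
  using sets_eq_imp_space_eq[OF sets_mu] by simp

lemma measurable_mu [simp]: "measurable \<mu> N = measurable borel N"
  by (rule measurable_cong_sets) simp_all

lemma card_fibre_pos: "card (r -` {x}) > 0"
proof -
  obtain y where "r y = x" using surj_r by (metis surjD)
  then have "r -` {x} \<noteq> {}" by auto
  then show ?thesis using finite_fibre[of x] by (simp add: card_gt_0_iff)
qed

lemma fibre_avg_const [simp]: "fibre_avg r (\<lambda>y. c) x = c"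
  using card_fibre_pos[of x] by (simp add: fibre_avg_def)

lemma fibre_avg_diff: "fibre_avg r (\<lambda>y. f y - g y) x = fibre_avg r f x - fibre_avg r g x"
  by (simp add: fibre_avg_def sum_subtractf right_diff_distrib diff_divide_distrib)

lemma integral_fibre_avg_Linf:
  assumes "f \<in> Linf \<mu>"
  shows "(\<integral>x. f x \<partial>\<mu>) = (\<integral>x. fibre_avg r f x \<partial>\<mu>)"
  using invariant assms unfolding strongly_invariant_def fibre_avg_def by blast

text \<open>The Bochner integral of a function that is not integrable is \<open>0\<close>. Hence strong invariance,
  applied to an indicator of positive measure, forces the average over the fibres to be measurable;
  an indicator of measure zero is handled through its complement.\<close>

lemma fibre_avg_indicator_measurable:
  assumes A: "A \<in> sets borel"
  shows "fibre_avg r (indicator A :: 'a \<Rightarrow> complex) \<in> borel_measurable borel"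
proof -
  have pos: "fibre_avg r (indicator B :: 'a \<Rightarrow> complex) \<in> borel_measurable borel"
    if B: "B \<in> sets borel" "measure \<mu> B \<noteq> 0" for B
  proof -
    have "(indicator B :: 'a \<Rightarrow> complex) \<in> Linf \<mu>"
      using B by (auto simp: Linf_def intro!: exI[of _ 1] AE_I2 split: split_indicator)
    then have "(\<integral>x. fibre_avg r (indicator B) x \<partial>\<mu>) = (\<integral>x. (indicator B x :: complex) \<partial>\<mu>)"
      by (simp add: integral_fibre_avg_Linf)
    moreover have "(\<lambda>x. indicator B x :: complex) = (\<lambda>x. of_real (indicat_real B x))"
      by (auto simp: fun_eq_iff split: split_indicator)
    moreover have "(\<integral>x. complex_of_real (indicat_real B x) \<partial>\<mu>) \<noteq> 0" using B by simp
    ultimately have "(\<integral>x. fibre_avg r (indicator B :: 'a \<Rightarrow> complex) x \<partial>\<mu>) \<noteq> 0" by metis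
    then have "integrable \<mu> (fibre_avg r (indicator B :: 'a \<Rightarrow> complex))"
      using not_integrable_integral_eq by blast
    then show ?thesis using borel_measurable_integrable measurable_mu by blast
  qed
  show ?thesis
  proof (cases "measure \<mu> A = 0")
    case True
    then have "measure \<mu> (- A) \<noteq> 0"
      using A prob_compl[of A] by (simp add: Compl_eq_Diff_UNIV)
    then have "(\<lambda>x. 1 - fibre_avg r (indicator (- A) :: 'a \<Rightarrow> complex) x) \<in> borel_measurable borel"
      using pos[of "- A"] A by (intro borel_measurable_diff) auto
    also have "(\<lambda>x. 1 - fibre_avg r (indicator (- A)) x)
        = fibre_avg r (\<lambda>y. 1 - indicator (- A) y :: complex)"
      by (simp add: fibre_avg_diff fun_eq_iff)
    also have "(\<lambda>y. 1 - indicator (- A) y :: complex) = indicator A"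
      by (auto simp: fun_eq_iff split: split_indicator)
    finally show ?thesis .
  qed (use pos A in blast)
qed

text \<open>Linearity passes from indicators to simple functions, and finite sums over fibres
  respect pointwise limits.\<close>

lemma fibre_avg_measurable [measurable (raw)]:
  fixes f :: "'a \<Rightarrow> complex"
  assumes f: "f \<in> borel_measurable borel"
  shows "fibre_avg r f \<in> borel_measurable borel"
proof -
  have simple: "fibre_avg r g \<in> borel_measurable borel" if g: "simple_function borel g"
    for g :: "'a \<Rightarrow> complex"
  proof -
    have fin: "finite (range g)" using simple_functionD(1)[OF g] by simp
    have "g y = (\<Sum>v\<in>range g. v * indicator (g -` {v}) y)" for y
      using fin by (simp add: indicator_def of_bool_def if_distrib[of "\<lambda>z. _ * z"] sum.If_cases
          cong: if_cong)
    then have "fibre_avg r g = (\<lambda>x. fibre_avg r (\<lambda>y. \<Sum>v\<in>range g. v * indicator (g -` {v}) y) x)"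
      by (metis (no_types, lifting) ext)
    also have "\<dots> = (\<lambda>x. \<Sum>v\<in>range g. v * fibre_avg r (indicator (g -` {v})) x)"
      unfolding fibre_avg_def
      by (intro ext, subst sum.swap) (simp add: sum_distrib_left mult_ac)
    also have "\<dots> \<in> borel_measurable borel"
      using simple_functionD(2)[OF g]
      by (intro borel_measurable_sum borel_measurable_times borel_measurable_const
          fibre_avg_indicator_measurable) simp
    finally show ?thesis .
  qed
  obtain F where F: "\<And>i. simple_function borel (F i)" "\<And>x. (\<lambda>i. F i x) \<longlonglongrightarrow> f x"
    using borel_measurable_implies_sequence_metric[OF f, of 0] by auto
  show ?thesis
  proof (rule borel_measurable_LIMSEQ_metric)
    show "fibre_avg r (F i) \<in> borel_measurable borel" for i by (rule simple[OF F(1)])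
    show "(\<lambda>i. fibre_avg r (F i) x) \<longlonglongrightarrow> fibre_avg r f x" for x
      by (rule fibre_avg_tendsto) (rule F(2))
  qed
qed

lemma fibre_avg_measurable_real [measurable (raw)]:
  fixes f :: "'a \<Rightarrow> real"
  assumes [measurable]: "f \<in> borel_measurable borel"
  shows "fibre_avg r f \<in> borel_measurable borel"
proof -
  have "(\<lambda>x. Re (fibre_avg r (\<lambda>y. complex_of_real (f y)) x)) \<in> borel_measurable borel"
    by measurable
  then show ?thesis by (simp add: fibre_avg_of_real)
qed

text \<open>Strong invariance speaks of bounded functions only; truncation at height
  \<open>n\<close> and monotone convergence reach integrable ones and give integrability of the
  average as well.\<close>

lemma fibre_avg_nonneg_integral:
  fixes f :: "'a \<Rightarrow> real"
  assumes f: "integrable \<mu> f" "\<And>x. f x \<ge> 0"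
  shows "integrable \<mu> (fibre_avg r f) \<and> (\<integral>x. fibre_avg r f x \<partial>\<mu>) = (\<integral>x. f x \<partial>\<mu>)"
proof -
  have [measurable]: "f \<in> borel_measurable borel"
    using borel_measurable_integrable[OF f(1)] by simp
  define g where "g n x = min (f x) (real n)" for n x
  have g[measurable]: "g n \<in> borel_measurable borel" for n unfolding g_def by measurable
  have bnd: "0 \<le> g n x" "g n x \<le> real n" for n x using f(2) by (auto simp: g_def)
  have g_int: "integrable \<mu> (g n)" for n
    using f by (intro Bochner_Integration.integrable_bound[OF f(1)]) (auto simp: g_def)
  have avg_int: "integrable \<mu> (fibre_avg r (g n))" for n
  proof (rule integrable_const_bound[of _ "real n"])
    have "fibre_avg r (g n) x \<le> real n" for x
      using fibre_avg_mono[of "g n" "\<lambda>_. real n" r x] bnd by simp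
    then show "AE x in \<mu>. norm (fibre_avg r (g n) x) \<le> real n"
      using fibre_avg_nonneg[of "g n" r] bnd by simp
  qed simp
  have eq: "(\<integral>x. fibre_avg r (g n) x \<partial>\<mu>) = (\<integral>x. g n x \<partial>\<mu>)" for n
  proof -
    have "(\<lambda>x. complex_of_real (g n x)) \<in> Linf \<mu>"
      using bnd by (auto simp: Linf_def intro!: exI[of _ "real n"] AE_I2)
    from integral_fibre_avg_Linf[OF this] show ?thesis
      by (simp add: fibre_avg_of_real)
  qed
  have lim_g: "(\<lambda>n. g n x) \<longlonglongrightarrow> f x" for x
  proof (rule tendsto_eventually)
    obtain N where "f x \<le> real N" using real_arch_simple by blast
    then show "\<forall>\<^sub>F n in sequentially. g n x = f x"
      by (auto simp: g_def eventually_sequentially intro!: exI[of _ N])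
  qed
  have lim_int: "(\<lambda>n. \<integral>x. g n x \<partial>\<mu>) \<longlonglongrightarrow> (\<integral>x. f x \<partial>\<mu>)"
    by (rule integral_dominated_convergence[where w=f]) (use f lim_g in \<open>auto simp: g_def\<close>)
  have mono: "mono (\<lambda>n. fibre_avg r (g n) x)" for x
    by (intro monoI fibre_avg_mono) (auto simp: g_def)
  have lim_avg: "AE x in \<mu>. (\<lambda>n. fibre_avg r (g n) x) \<longlonglongrightarrow> fibre_avg r f x"
    by (intro AE_I2 fibre_avg_tendsto lim_g)
  show ?thesis
    using has_bochner_integral_monotone_convergence[of \<mu> "\<lambda>n. fibre_avg r (g n)" "fibre_avg r f" "\<integral>x. f x \<partial>\<mu>"]
      avg_int mono lim_avg lim_int
    by (simp add: eq has_bochner_integral_iff)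
qed

text \<open>Cutting \<open>f\<close> to zero where it is large gives bounded functions; the average
  of |f|, integrable by the nonnegative case, dominates their averages.\<close>

lemma fibre_avg_integral:
  fixes f :: "'a \<Rightarrow> complex"
  assumes f: "integrable \<mu> f"
  shows "integrable \<mu> (fibre_avg r f)" "(\<integral>x. fibre_avg r f x \<partial>\<mu>) = (\<integral>x. f x \<partial>\<mu>)"
proof -
  have [measurable]: "f \<in> borel_measurable borel"
    using borel_measurable_integrable[OF f(1)] by simp
  have dom: "integrable \<mu> (fibre_avg r (\<lambda>y. cmod (f y)))"
    using fibre_avg_nonneg_integral[of "\<lambda>y. cmod (f y)"] f by auto
  then show "integrable \<mu> (fibre_avg r f)"
    by (rule Bochner_Integration.integrable_bound)
      (auto intro!: AE_I2 order_trans[OF norm_fibre_avg_le])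
  define g where "g n x = (if cmod (f x) \<le> real n then f x else 0)" for n x
  have g[measurable]: "g n \<in> borel_measurable borel" for n unfolding g_def by measurable
  have lim_g: "(\<lambda>n. g n x) \<longlonglongrightarrow> f x" for x
  proof (rule tendsto_eventually)
    obtain N where "cmod (f x) \<le> real N" using real_arch_simple by blast
    then show "\<forall>\<^sub>F n in sequentially. g n x = f x"
      by (auto simp: g_def eventually_sequentially intro!: exI[of _ N])
  qed
  have gf: "cmod (g n x) \<le> cmod (f x)" for n x by (simp add: g_def)
  have "(\<lambda>n. \<integral>x. fibre_avg r (g n) x \<partial>\<mu>) \<longlonglongrightarrow> (\<integral>x. fibre_avg r f x \<partial>\<mu>)"
    by (rule integral_dominated_convergence[where w="fibre_avg r (\<lambda>y. cmod (f y))"])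
      (use dom in \<open>auto intro!: AE_I2 fibre_avg_tendsto lim_g
        order_trans[OF norm_fibre_avg_le fibre_avg_mono] gf\<close>)
  moreover have "(\<integral>x. fibre_avg r (g n) x \<partial>\<mu>) = (\<integral>x. g n x \<partial>\<mu>)" for n
    by (intro integral_fibre_avg_Linf[symmetric])
      (auto simp: Linf_def g_def intro!: exI[of _ "real n"] AE_I2)
  moreover have "(\<lambda>n. \<integral>x. g n x \<partial>\<mu>) \<longlonglongrightarrow> (\<integral>x. f x \<partial>\<mu>)"
    by (rule integral_dominated_convergence[where w="\<lambda>x. cmod (f x)"])
      (use f in \<open>auto intro!: AE_I2 lim_g gf\<close>)
  ultimately show "(\<integral>x. fibre_avg r f x \<partial>\<mu>) = (\<integral>x. f x \<partial>\<mu>)"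
    using LIMSEQ_unique by simp
qed

lemma fibre_avg_pow_integral:
  fixes f :: "'a \<Rightarrow> complex"
  assumes "integrable \<mu> f"
  shows "integrable \<mu> ((fibre_avg r ^^ n) f)" "(\<integral>x. (fibre_avg r ^^ n) f x \<partial>\<mu>) = (\<integral>x. f x \<partial>\<mu>)"
  using assms by (induction n) (auto simp: fibre_avg_integral)

lemma fibre_avg_pow_of_real:
  "(fibre_avg r ^^ n) (\<lambda>y. of_real (f y)) = (\<lambda>x. of_real ((fibre_avg r ^^ n) f x))"
  by (induction n) (simp_all add: fibre_avg_of_real)

lemma fibre_avg_pow_integral_real:
  fixes f :: "'a \<Rightarrow> real"
  assumes "integrable \<mu> f"
  shows "(\<integral>x. (fibre_avg r ^^ n) f x \<partial>\<mu>) = (\<integral>x. f x \<partial>\<mu>)"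
  using fibre_avg_pow_integral(2)[of "\<lambda>x. complex_of_real (f x)" n] assms
  by (simp add: fibre_avg_pow_of_real)

text \<open>The average of the indicator of a null set has integral zero, so it vanishes almost
  everywhere; as fibres are finite and nonempty, almost every fibre misses the null set.\<close>

lemma AE_fibre:
  assumes "AE x in \<mu>. P x"
  shows "AE x in \<mu>. \<forall>y. r y = x \<longrightarrow> P y"
proof -
  obtain N where N: "{x. \<not> P x} \<subseteq> N" "emeasure \<mu> N = 0" "N \<in> sets borel"
    using AE_E[OF assms] by auto
  have int: "integrable \<mu> (indicator N :: 'a \<Rightarrow> real)" using N by simp
  have nn: "fibre_avg r (indicator N) x \<ge> (0::real)" for x by (rule fibre_avg_nonneg) simp
  have "(\<integral>x. fibre_avg r (indicator N) x \<partial>\<mu>) = (0::real)"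
    using fibre_avg_nonneg_integral[OF int] N by (simp add: measure_def)
  then have "AE x in \<mu>. fibre_avg r (indicator N) x = (0::real)"
    using nn fibre_avg_nonneg_integral[OF int] by (subst (asm) integral_nonneg_eq_0_iff_AE) auto
  then show ?thesis
  proof eventually_elim
    case (elim x)
    then have "(\<Sum>y\<in>r -` {x}. indicator N y :: real) = 0"
      using card_fibre_pos[of x] by (simp add: fibre_avg_def)
    then have "\<forall>y\<in>r -` {x}. indicator N y = (0::real)"
      by (subst (asm) sum_nonneg_eq_0_iff) (auto simp: finite_fibre)
    then show ?case using N(1) by (force simp: indicator_def split: if_splits)
  qed
qed

text \<open>The indicator of a preimage under \<open>r\<close> is constant on fibres, so its average
  is the indicator of the set itself.\<close>

lemma distr_r: "distr \<mu> borel r = \<mu>"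
proof (rule measure_eqI)
  fix A assume "A \<in> sets (distr \<mu> borel r)"
  then have A[measurable]: "A \<in> sets borel" by simp
  have rA: "r -` A \<in> sets borel" using measurable_sets[OF r_measurable A] by simp
  \<comment> \<open>The factor 1 brings the indicator into the shape of
    \<open>fibre_avg_pull_out\<close>.\<close>
  have e: "indicat_real (r -` A) = (\<lambda>y. indicator A (r y) * 1)"
    by (auto split: split_indicator)
  have "fibre_avg r (indicat_real (r -` A)) = indicator A"
    unfolding e by (rule ext, subst fibre_avg_pull_out) simp
  moreover have "integrable \<mu> (indicat_real (r -` A))"
    using rA by (intro integrable_real_indicator) (auto simp: emeasure_eq_measure)
  ultimately have "measure \<mu> A = measure \<mu> (r -` A)"
    using fibre_avg_nonneg_integral[of "indicator (r -` A)"] rA A by simp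
  then show "emeasure (distr \<mu> borel r) A = emeasure \<mu> A"
    by (simp add: emeasure_distr emeasure_eq_measure)
qed simp

lemma AE_r_pow:
  assumes "AE x in \<mu>. P x"
  shows "AE x in \<mu>. P ((r ^^ n) x)"
proof (induction n)
  case (Suc n)
  have "AE x in distr \<mu> borel r. P ((r ^^ n) x)" unfolding distr_r by (rule Suc.IH)
  then have "AE x in \<mu>. P ((r ^^ n) (r x))" by (rule AE_distrD[rotated]) simp
  then show ?case by (simp add: funpow_swap1)
qed (use assms in simp)

lemma r_pow_measurable [measurable]: "r ^^ n \<in> borel \<rightarrow>\<^sub>M borel"
proof (induction n)
  case (Suc n)
  then show ?case using measurable_comp[OF _ r_measurable] by simp
qed (simp add: id_def)

end

section \<open>The measures \<open>\<omega> n\<close> as densities\<close>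

locale weighted_system = invariant_system \<mu> r
  for \<mu> :: "'a::topological_space measure" and r :: "'a \<Rightarrow> 'a" +
  fixes m0 :: "'a \<Rightarrow> complex" and h :: "'a \<Rightarrow> real"
  assumes m0: "m0 \<in> Linf \<mu>"
    and h_integrable: "integrable \<mu> h" and h_nonneg: "AE x in \<mu>. 0 \<le> h x"
    and h_fixed: "AE x in \<mu>. transfer_op r m0 h x = h x"
begin

abbreviation "\<omega> \<equiv> omega r \<mu> m0 h"
abbreviation "w \<equiv> weight r m0"

lemma m0_measurable [measurable]: "m0 \<in> borel_measurable borel"
  using m0 by (auto simp: Linf_def)

lemma h_measurable [measurable]: "h \<in> borel_measurable borel"
  using borel_measurable_integrable[OF h_integrable] by simp

lemma weight_measurable [measurable]: "w n \<in> borel_measurable borel"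
  unfolding weight_def by measurable

lemma weight_h_nonneg: "AE x in \<mu>. 0 \<le> w n x * h x"
  using h_nonneg by eventually_elim (simp add: weight_nonneg)

text \<open>The essential bound \<open>C\<close> of \<open>m0\<close> holds along almost every orbit
  because \<open>r\<close> preserves \<open>\<mu>\<close>, so the weight is at most (C^2)^n almost
  everywhere.\<close>

lemma weight_h_integrable: "integrable \<mu> (\<lambda>x. w n x * h x)"
proof -
  obtain C where "AE x in \<mu>. cmod (m0 x) \<le> C" using m0 by (auto simp: Linf_def)
  then have "AE x in \<mu>. \<forall>k. cmod (m0 ((r ^^ k) x)) \<le> C"
    using AE_r_pow by (subst AE_all_countable) blast
  then have bnd: "AE x in \<mu>. norm (w n x * h x) \<le> norm ((C\<^sup>2) ^ n * h x)"
  proof eventually_elim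
    case (elim x)
    have "w n x \<le> (\<Prod>k<n. C\<^sup>2)"
      unfolding weight_def using elim by (intro prod_mono conjI power_mono) auto
    then show ?case
      by (auto simp: abs_mult weight_nonneg intro!: mult_right_mono)
  qed
  show ?thesis
    by (rule Bochner_Integration.integrable_bound[OF integrable_mult_right[OF h_integrable] _ bnd]) simp
qed

text \<open>The set function in \<open>omega\<close> agrees on Borel sets with a measure already
  known, so \<open>measure_of\<close> returns that measure and countable additivity comes for
  free.\<close>

lemma omega_eq_density: "\<omega> n = density \<mu> (\<lambda>x. w n x * h x)"
proof -
  have eq: "ennreal (\<integral>x. (transfer_op r m0 ^^ n) (\<lambda>y. indicator A y * h y) x \<partial>\<mu>)
      = emeasure (density \<mu> (\<lambda>x. w n x * h x)) A" if A[measurable]: "A \<in> sets borel" for A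
  proof -
    have int: "integrable \<mu> (\<lambda>x. w n x * (indicator A x * h x))"
      using integrable_mult_indicator[OF _ weight_h_integrable[of n], of A]
      by (simp add: mult.left_commute)
    then have "ennreal (\<integral>x. (transfer_op r m0 ^^ n) (\<lambda>y. indicator A y * h y) x \<partial>\<mu>)
        = ennreal (\<integral>x. w n x * (indicator A x * h x) \<partial>\<mu>)"
      by (simp add: transfer_op_pow fibre_avg_pow_integral_real)
    also have "\<dots> = (\<integral>\<^sup>+x. ennreal (w n x * (indicator A x * h x)) \<partial>\<mu>)"
      using h_nonneg
      by (intro nn_integral_eq_integral[symmetric] int, eventually_elim) (simp add: weight_nonneg)
    also have "\<dots> = (\<integral>\<^sup>+x. ennreal (w n x * h x) * indicator A x \<partial>\<mu>)"
      by (intro nn_integral_cong) (auto split: split_indicator)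
    finally show ?thesis by (simp add: emeasure_density)
  qed
  have "\<omega> n = measure_of UNIV (sets borel) (emeasure (density \<mu> (\<lambda>x. w n x * h x)))"
    unfolding omega_def
    by (rule measure_of_eq) (auto simp: eq sets.sigma_sets_eq[of borel, simplified])
  also have "\<dots> = density \<mu> (\<lambda>x. w n x * h x)"
    using measure_of_of_measure[of "density \<mu> (\<lambda>x. w n x * h x)"] by simp
  finally show ?thesis .
qed

lemma sets_omega [measurable_cong, simp]: "sets (\<omega> n) = sets borel"
  by (simp add: omega_eq_density)

lemma space_omega [simp]: "space (\<omega> n) = UNIV"
  by (simp add: omega_eq_density)

lemma measurable_omega [simp]: "measurable (\<omega> n) N = measurable borel N"
  by (rule measurable_cong_sets) simp_all

lemma AE_omega: "(AE x in \<omega> n. P x) \<longleftrightarrow> (AE x in \<mu>. 0 < w n x * h x \<longrightarrow> P x)"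
  unfolding omega_eq_density by (subst AE_density) auto

lemma integrable_omega:
  fixes f :: "'a \<Rightarrow> complex"
  assumes [measurable]: "f \<in> borel_measurable borel"
  shows "integrable (\<omega> n) f \<longleftrightarrow> integrable \<mu> (\<lambda>x. of_real (w n x) * (f x * of_real (h x)))"
  unfolding omega_eq_density using weight_h_nonneg
  by (subst integrable_density) (auto simp: scaleR_conv_of_real mult_ac)

lemma integral_omega:
  fixes f :: "'a \<Rightarrow> complex"
  assumes [measurable]: "f \<in> borel_measurable borel"
  shows "(\<integral>x. f x \<partial>\<omega> n) = (\<integral>x. of_real (w n x) * (f x * of_real (h x)) \<partial>\<mu>)"
  unfolding omega_eq_density using weight_h_nonneg
  by (subst integral_density) (auto simp: scaleR_conv_of_real mult_ac)

lemma omega_Suc: "\<omega> (Suc n) = density (\<omega> n) (\<lambda>x. (cmod (m0 ((r ^^ n) x)))\<^sup>2)"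
  unfolding omega_eq_density
  by (subst density_density_eq, simp, simp)
    (intro density_cong; auto simp: weight_Suc ennreal_mult'' mult_ac simp flip: ennreal_mult'')

lemma integral_transfer_op_pow:
  assumes f: "integrable (\<omega> n) f"
  shows "(\<integral>x. (transfer_op r m0 ^^ n) (\<lambda>y. f y * complex_of_real (h y)) x \<partial>\<mu>) = (\<integral>x. f x \<partial>\<omega> n)"
proof -
  have m: "f \<in> borel_measurable borel" using borel_measurable_integrable[OF f] by simp
  show ?thesis
    using f m by (simp add: transfer_op_pow fibre_avg_pow_integral integrable_omega integral_omega)
qed

text \<open>At a zero of \<open>h\<close> the fixed point equation is a vanishing sum of the
  nonnegative terms |m0|^2 h over the fibre, so every term is zero. One null set therefore serves
  all \<open>\<xi>\<close> at once.\<close>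

lemma transfer_op_vanishes:
  "AE x in \<mu>. h x = 0 \<longrightarrow> (\<forall>\<xi>. transfer_op r m0 (\<lambda>y. \<xi> y * complex_of_real (h y)) x = 0)"
  using AE_fibre[OF h_nonneg] h_fixed
proof eventually_elim
  case (elim x)
  show ?case
  proof (intro impI allI)
    fix \<xi> :: "'a \<Rightarrow> complex"
    assume "h x = 0"
    then have "(\<Sum>y\<in>r -` {x}. (cmod (m0 y))\<^sup>2 * h y) = 0"
      using elim card_fibre_pos[of x] by (simp add: transfer_op_def)
    then have "\<forall>y\<in>r -` {x}. (cmod (m0 y))\<^sup>2 * h y = 0"
      by (subst (asm) sum_nonneg_eq_0_iff) (auto simp: finite_fibre elim)
    then have "(\<Sum>y\<in>r -` {x}. of_real ((cmod (m0 y))\<^sup>2) * (\<xi> y * complex_of_real (h y))) = 0"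
      by (intro sum.neutral) auto
    then show "transfer_op r m0 (\<lambda>y. \<xi> y * complex_of_real (h y)) x = 0"
      by (simp add: transfer_op_def)
  qed
qed

end

section \<open>The solenoid\<close>

lemma square_integrable_mult_bounded:
  assumes f: "f \<in> square_integrable M" and g: "g \<in> borel_measurable M"
    and bound: "AE x in M. cmod (g x) \<le> C"
  shows "(\<lambda>x. g x * f x) \<in> square_integrable M"
proof -
  have [measurable]: "f \<in> borel_measurable M" "g \<in> borel_measurable M"
    using f g by (auto simp: square_integrable_def)
  have "integrable M (\<lambda>x. (cmod (g x * f x))\<^sup>2)"
  proof (rule Bochner_Integration.integrable_bound)
    show "integrable M (\<lambda>x. C\<^sup>2 * (cmod (f x))\<^sup>2)" using f by (auto simp: square_integrable_def)
    show "AE x in M. norm ((cmod (g x * f x))\<^sup>2) \<le> norm (C\<^sup>2 * (cmod (f x))\<^sup>2)"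
      using bound by eventually_elim
        (auto simp: norm_mult power_mult_distrib intro!: mult_right_mono power_mono)
  qed simp
  then show ?thesis by (simp add: square_integrable_def)
qed

lemma (in finite_measure) square_integrable_imp_integrable:
  assumes "f \<in> square_integrable M"
  shows "integrable M f"
proof -
  have "(\<lambda>_. 1) \<in> square_integrable M" by (simp add: square_integrable_def)
  from integrable_cnj_mult[OF this assms] show ?thesis by simp
qed

lemma L2_carrier_eq: "vcarrier (L2 M) = ae_class M ` square_integrable M"
  by (auto elim: L2_carrierE intro: L2_carrierI)

lemma Xinf_pow: "x \<in> Xinf r \<Longrightarrow> (r ^^ k) (theta (n + k) x) = theta n x"
  by (induction k) (auto simp: theta_def Xinf_def funpow_swap1)

lemma rhat_Xinf: "x \<in> Xinf r \<Longrightarrow> rhat r x \<in> Xinf r"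
  by (auto simp: Xinf_def rhat_def split: nat.split)

lemma theta_Suc_rhat [simp]: "theta (Suc n) (rhat r x) = theta n x"
  by (simp add: theta_def rhat_def)

lemma theta_rhat: "x \<in> Xinf r \<Longrightarrow> theta n (rhat r x) = r (theta n x)"
  by (cases n) (auto simp: theta_def rhat_def Xinf_def)

locale solenoid_system = weighted_system \<mu> r m0 h
  for \<mu> :: "'a::topological_space measure" and r m0 h +
  fixes M :: "(nat \<Rightarrow> 'a) measure"
  assumes sets_M: "sets M = sets (Xinf_space r)"
    and distr_theta: "distr M borel (theta n) = \<omega> n"
begin

definition cylinders :: "(nat \<Rightarrow> 'a) set set" where
  "cylinders = {theta n -` A \<inter> Xinf r |n A. A \<in> sets borel}"

lemma cylinders_Pow: "cylinders \<subseteq> Pow (Xinf r)"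
  by (auto simp: cylinders_def)

lemma sets_M_sigma: "sets M = sigma_sets (Xinf r) cylinders"
  using cylinders_Pow unfolding sets_M Xinf_space_def cylinders_def by simp

lemma space_M: "space M = Xinf r"
  using sets_eq_imp_space_eq[OF sets_M] cylinders_Pow
  by (simp add: Xinf_space_def cylinders_def)

lemma theta_measurable [measurable]: "theta n \<in> M \<rightarrow>\<^sub>M borel"
  by (rule measurableI) (auto simp: sets_M_sigma space_M cylinders_def intro: sigma_sets.Basic)

lemma theta_eq_pow:
  assumes "x \<in> Xinf r" "n \<le> m"
  shows "theta n x = (r ^^ (m - n)) (theta m x)"
  using Xinf_pow[OF assms(1), of "m - n" n] assms(2) by simp

text \<open>Two cylinders can be moved to the same level, since \<open>\<theta>\<^sub>n = r\<^sup>m\<^sup>-\<^sup>n \<circ> \<theta>\<^sub>m\<close> for \<open>n \<le> m\<close>.\<close>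

lemma Int_stable_cylinders: "Int_stable cylinders"
proof (rule Int_stableI)
  fix a b assume "a \<in> cylinders" "b \<in> cylinders"
  then obtain n A m B where ab: "a = theta n -` A \<inter> Xinf r" "b = theta m -` B \<inter> Xinf r"
    and AB: "A \<in> sets borel" "B \<in> sets borel" by (auto simp: cylinders_def)
  define k where "k = max n m"
  have "a \<inter> b = theta k -` ((r ^^ (k - n)) -` A \<inter> (r ^^ (k - m)) -` B) \<inter> Xinf r"
    unfolding ab using theta_eq_pow[of _ n k] theta_eq_pow[of _ m k] by (auto simp: k_def)
  moreover have "(r ^^ (k - n)) -` A \<inter> (r ^^ (k - m)) -` B \<in> sets borel"
    using measurable_sets[OF r_pow_measurable AB(1)] measurable_sets[OF r_pow_measurable AB(2)]
    by (intro sets.Int) simp_all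
  ultimately show "a \<inter> b \<in> cylinders" unfolding cylinders_def by blast
qed

lemma theta_Suc: "x \<in> space M \<Longrightarrow> r (theta (Suc n) x) = theta n x"
  by (simp add: space_M Xinf_def theta_def)

lemma theta_pow: "x \<in> space M \<Longrightarrow> (r ^^ n) (theta n x) = theta 0 x"
  using Xinf_pow[of x r n 0] by (simp add: space_M)

text \<open>Read off from the solenoid, where \<open>r\<close> composed with
  \<open>theta (Suc n)\<close> is \<open>theta n\<close>.\<close>

lemma distr_omega_r: "distr (\<omega> (Suc n)) borel r = \<omega> n"
  unfolding distr_theta[symmetric]
  by (subst distr_distr) (auto intro!: distr_cong simp: theta_Suc)

lemma AE_theta:
  assumes "AE x in \<omega> n. P x"
  shows "AE z in M. P (theta n z)"
  using assms unfolding distr_theta[symmetric] by (rule AE_distrD[OF theta_measurable])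

lemma integral_theta:
  fixes f :: "'a \<Rightarrow> complex"
  shows "f \<in> borel_measurable borel \<Longrightarrow> (\<integral>z. f (theta n z) \<partial>M) = (\<integral>x. f x \<partial>\<omega> n)"
  using integral_distr[OF theta_measurable, of f n] by (simp add: distr_theta)

lemma integrable_theta:
  fixes f :: "'a \<Rightarrow> 'b::{banach, second_countable_topology}"
  shows "f \<in> borel_measurable borel \<Longrightarrow> integrable M (\<lambda>z. f (theta n z)) \<longleftrightarrow> integrable (\<omega> n) f"
  using integrable_distr_eq[OF theta_measurable, of f n] by (simp add: distr_theta)

lemma square_integrable_omegaD:
  "f \<in> square_integrable (\<omega> n) \<Longrightarrow> f \<in> borel_measurable borel"
  by (simp add: square_integrable_def)

lemma square_integrable_theta:
  assumes "f \<in> square_integrable (\<omega> n)"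
  shows "(\<lambda>z. f (theta n z)) \<in> square_integrable M"
  using assms integrable_theta[of "\<lambda>x. (cmod (f x))\<^sup>2" n] by (auto simp: square_integrable_def)

lemma square_integrable_r:
  assumes "f \<in> square_integrable (\<omega> n)"
  shows "(\<lambda>x. f (r x)) \<in> square_integrable (\<omega> (Suc n))"
  using assms integrable_distr_eq[of r "\<omega> (Suc n)" borel "\<lambda>x. (cmod (f x))\<^sup>2"]
  by (auto simp: square_integrable_def distr_omega_r)

lemma finite_measure_omega: "finite_measure (\<omega> n)"
proof
  have "emeasure (\<omega> n) UNIV = (\<integral>\<^sup>+x. ennreal (w n x * h x) \<partial>\<mu>)"
    by (simp add: omega_eq_density emeasure_density)
  also have "\<dots> < \<infinity>"
    using nn_integral_eq_integral[OF weight_h_integrable weight_h_nonneg] by simp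
  finally show "emeasure (\<omega> n) (space (\<omega> n)) \<noteq> \<infinity>" by simp
qed

lemma finite_measure_M: "finite_measure M"
proof
  have "emeasure M (space M) = emeasure (distr M borel (theta 0)) UNIV"
    by (simp add: emeasure_distr)
  then show "emeasure M (space M) \<noteq> \<infinity>"
    using finite_measure.emeasure_finite[OF finite_measure_omega] by (simp add: distr_theta)
qed

sublocale M: finite_measure M by (rule finite_measure_M)

lemma one_square_integrable:
  "(\<lambda>x. 1) \<in> square_integrable (\<omega> n)" "(\<lambda>x. 1) \<in> square_integrable M"
  using finite_measure.integrable_const[OF finite_measure_omega] by (auto simp: square_integrable_def)

lemma i_map_ae_class:
  assumes f: "f \<in> square_integrable (\<omega> n)"
  shows "i_map M n (ae_class (\<omega> n) f) = ae_class M (\<lambda>z. f (theta n z))"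
  unfolding i_map_def
  using rep_ae_class[OF f] AE_theta[OF rep_ae_class(2)[OF f]]
  by (subst ae_class_eq_iff) (auto intro: square_integrable_theta f)

lemma isometric_embedding_i_map: "isometric_embedding (L2 M) (L2 (\<omega> n)) (i_map M n)"
proof (intro isometric_embedding.intro complex_hilbert_space_L2 isometric_embedding_axioms.intro)
  note rules = square_integrable_add square_integrable_scale square_integrable_theta
  note simps = i_map_ae_class L2_vadd L2_vscale rules
  fix u v c assume u: "u \<in> vcarrier (L2 (\<omega> n))"
  show "i_map M n u \<in> vcarrier (L2 M)"
    using u by (elim L2_carrierE) (auto simp: simps intro: L2_carrierI rules)
  show "i_map M n (vscale (L2 (\<omega> n)) c u) = vscale (L2 M) c (i_map M n u)"
    using u by (elim L2_carrierE) (simp add: simps)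
  assume v: "v \<in> vcarrier (L2 (\<omega> n))"
  show "i_map M n (vadd (L2 (\<omega> n)) u v) = vadd (L2 M) (i_map M n u) (i_map M n v)"
    using u v by (elim L2_carrierE) (simp add: simps)
  obtain f g where f: "f \<in> square_integrable (\<omega> n)" "u = ae_class (\<omega> n) f"
    and g: "g \<in> square_integrable (\<omega> n)" "v = ae_class (\<omega> n) g"
    using u v by (elim L2_carrierE)
  have [measurable]: "f \<in> borel_measurable borel" "g \<in> borel_measurable borel"
    using f g by (auto dest: square_integrable_omegaD)
  show "vinner (L2 M) (i_map M n u) (i_map M n v) = vinner (L2 (\<omega> n)) u v"
    using f g integral_theta[of "\<lambda>x. cnj (f x) * g x" n] by (simp add: simps L2_vinner)
qed

text \<open>Testing against indicators kills the integral of \<open>f\<close> over every cylinder.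
  Sets with vanishing integral are closed under complements and disjoint unions, so the cylinders,
  being stable under intersection, reach the whole sigma-algebra.\<close>

lemma cylinder_functions_total:
  assumes f: "f \<in> square_integrable M"
    and orth: "\<And>n x. x \<in> square_integrable (\<omega> n) \<Longrightarrow> (\<integral>z. cnj (x (theta n z)) * f z \<partial>M) = 0"
  shows "AE z in M. f z = 0"
proof (rule M.density_zero)
  have f_int: "integrable M f" using M.square_integrable_imp_integrable f by blast
  then show "integrable M f" .
  have set_int: "set_integrable M A f" if "A \<in> sets M" for A
    unfolding set_integrable_def using that f_int by (rule integrable_mult_indicator)
  have cyl: "set_lebesgue_integral M A f = 0" if A: "A \<in> cylinders" for A
  proof -
    obtain n B where B: "A = theta n -` B \<inter> Xinf r" "B \<in> sets borel"
      using A by (auto simp: cylinders_def)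
    have "(\<lambda>x. indicator B x * 1) \<in> square_integrable (\<omega> n)"
      using B(2) by (intro square_integrable_mult_bounded[where C=1] one_square_integrable)
        (auto split: split_indicator)
    from orth[OF this] have "0 = (\<integral>z. cnj (indicator B (theta n z)) * f z \<partial>M)" by simp
    also have "\<dots> = (\<integral>z. indicator A z *\<^sub>R f z \<partial>M)"
      by (intro Bochner_Integration.integral_cong)
        (auto simp: B space_M split: split_indicator)
    finally show ?thesis by (simp add: set_lebesgue_integral_def)
  qed
  fix A assume "A \<in> sets M"
  then have "A \<in> sigma_sets (Xinf r) cylinders" by (simp add: sets_M_sigma)
  from Int_stable_cylinders cylinders_Pow this
  show "set_lebesgue_integral M A f = 0"
  proof (induction rule: sigma_sets_induct_disjoint)
    case (basic A)
    then show ?case by (rule cyl)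
  next
    case empty
    show ?case by (simp add: set_lebesgue_integral_def)
  next
    case (compl A)
    have "Xinf r \<in> cylinders"
      unfolding cylinders_def by (intro CollectI exI[of _ 0] exI[of _ UNIV]) simp
    then have X: "set_lebesgue_integral M (Xinf r) f = 0" "Xinf r \<in> sets M"
      by (rule cyl) (simp add: space_M[symmetric])
    have A: "A \<in> sets M" "A \<subseteq> Xinf r"
      using compl sets.sets_into_space[of A M] by (simp_all add: sets_M_sigma space_M)
    have "set_lebesgue_integral M (A \<union> (Xinf r - A)) f
        = set_lebesgue_integral M A f + set_lebesgue_integral M (Xinf r - A) f"
      by (rule set_integral_Un) (use A X in \<open>auto intro: set_int\<close>)
    moreover have "A \<union> (Xinf r - A) = Xinf r" using A by auto
    ultimately show ?case using X compl by simp
  next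
    case (union A)
    have "set_lebesgue_integral M (\<Union>i. A i) f = (\<Sum>i. set_lebesgue_integral M (A i) f)"
      using union by (intro lebesgue_integral_countable_add set_int)
        (auto simp: disjoint_family_on_def sets_M_sigma[symmetric])
    then show ?case using union by simp
  qed
qed

sublocale T: isometric_tower "L2 M" "\<lambda>n. L2 (\<omega> n)" "i_map M"
proof (intro isometric_tower.intro complex_hilbert_space_L2 isometric_tower_axioms.intro
    isometric_embedding_i_map)
  fix n
  show "i_map M n ` vcarrier (L2 (\<omega> n)) \<subseteq> i_map M (Suc n) ` vcarrier (L2 (\<omega> (Suc n)))"
  proof
    fix v assume "v \<in> i_map M n ` vcarrier (L2 (\<omega> n))"
    then obtain f where f: "f \<in> square_integrable (\<omega> n)" "v = ae_class M (\<lambda>z. f (theta n z))"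
      by (auto elim!: L2_carrierE simp: i_map_ae_class)
    \<comment> \<open>A function \<open>f\<close> at level \<open>n\<close> is the function
      \<open>f \<circ> r\<close> at the next level.\<close>
    have "v = ae_class M (\<lambda>z. f (r (theta (Suc n) z)))"
      unfolding f(2) using square_integrable_theta[OF f(1)]
        square_integrable_theta[OF square_integrable_r[OF f(1)]]
      by (subst ae_class_eq_iff) (auto simp: theta_Suc)
    also have "\<dots> = i_map M (Suc n) (ae_class (\<omega> (Suc n)) (\<lambda>x. f (r x)))"
      by (simp add: i_map_ae_class square_integrable_r f(1))
    finally show "v \<in> i_map M (Suc n) ` vcarrier (L2 (\<omega> (Suc n)))"
      using L2_carrierI square_integrable_r[OF f(1)] by blast
  qed
next
  fix v assume v: "v \<in> vcarrier (L2 M)"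
    and orth: "\<And>n x. x \<in> vcarrier (L2 (\<omega> n)) \<Longrightarrow> vinner (L2 M) (i_map M n x) v = 0"
  obtain f where f: "f \<in> square_integrable M" "v = ae_class M f" using v by (rule L2_carrierE)
  have "(\<integral>z. cnj (x (theta n z)) * f z \<partial>M) = 0" if "x \<in> square_integrable (\<omega> n)" for n x
    using orth[OF L2_carrierI[OF that]] that f
    by (simp add: i_map_ae_class L2_vinner square_integrable_theta)
  then have "AE z in M. f z = 0" using cylinder_functions_total f(1) by blast
  then show "v = vzero (L2 M)"
    by (simp add: L2_vzero f ae_class_eq_iff square_integrable_zero)
qed

lemma components_eq_Phi: "T.components = Phi \<omega> M"
  by (simp add: fun_eq_iff T.components_def isometric_embedding.adj_def[OF isometric_embedding_i_map]
      Phi_def H_sub_def)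

text \<open>The identity \<open>R (\<xi> h) = \<eta> h\<close> says that \<open>\<eta>\<close> is the conditional expectation of \<open>\<xi>\<close>. Both sides
  vanish where \<open>h\<close> does, so it suffices to have it \<open>\<omega>\<^sub>n\<close>-almost everywhere.\<close>

lemma transfer_op_eq_iff_martingale:
  assumes \<xi>: "\<xi> \<in> square_integrable (\<omega> (Suc n))" and \<eta>: "\<eta> \<in> square_integrable (\<omega> n)"
  shows "(AE x in \<omega> n. transfer_op r m0 (\<lambda>y. \<xi> y * complex_of_real (h y)) x = \<eta> x * complex_of_real (h x))
    \<longleftrightarrow> (\<forall>f\<in>square_integrable (\<omega> n).
          (\<integral>x. cnj (f (r x)) * \<xi> x \<partial>\<omega> (Suc n)) = (\<integral>x. cnj (f x) * \<eta> x \<partial>\<omega> n))"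
    (is "?ae \<longleftrightarrow> ?mart")
proof -
  have [measurable]: "\<xi> \<in> borel_measurable borel" "\<eta> \<in> borel_measurable borel"
    using \<xi> \<eta> by (auto dest: square_integrable_omegaD)
  \<comment> \<open>The factor \<open>w n\<close> trades the measure \<open>\<omega> n\<close> for
    \<open>\<mu>\<close>: both sides become integrable functions that can be compared modulo
    \<open>\<mu>\<close>.\<close>
  define a where "a x = of_real (w n x) * transfer_op r m0 (\<lambda>y. \<xi> y * complex_of_real (h y)) x" for x
  define b where "b x = complex_of_real (w n x) * (\<eta> x * complex_of_real (h x))" for x
  have a_meas[measurable]: "a \<in> borel_measurable borel"
    unfolding a_def transfer_op_eq_fibre_avg by measurable
  have b_meas[measurable]: "b \<in> borel_measurable borel" unfolding b_def by measurable
  have ae: "?ae \<longleftrightarrow> (AE x in \<mu>. a x = b x)"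
  proof -
    have "?ae \<longleftrightarrow> (AE x in \<mu>. 0 < w n x * h x \<longrightarrow> a x = b x)"
      unfolding AE_omega
      by (intro AE_cong) (auto simp: a_def b_def zero_less_mult_iff weight_nonneg)
    also have "\<dots> \<longleftrightarrow> (AE x in \<mu>. a x = b x)"
    proof
      assume "AE x in \<mu>. 0 < w n x * h x \<longrightarrow> a x = b x"
      with transfer_op_vanishes h_nonneg show "AE x in \<mu>. a x = b x"
      proof eventually_elim
        case (elim x)
        consider "h x = 0" | "w n x = 0" | "0 < w n x * h x"
          using elim(2) weight_nonneg[of r m0 n x] by (auto simp: zero_less_mult_iff less_le)
        then show ?case using elim by cases (auto simp: a_def b_def)
      qed
    qed (auto elim: eventually_mono)
    finally show ?thesis .
  qed
  have lhs: "integrable \<mu> (\<lambda>x. cnj (f x) * a x)"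
    "(\<integral>x. cnj (f (r x)) * \<xi> x \<partial>\<omega> (Suc n)) = (\<integral>x. cnj (f x) * a x \<partial>\<mu>)"
    if f: "f \<in> square_integrable (\<omega> n)" for f
  proof -
    have [measurable]: "f \<in> borel_measurable borel" using f by (rule square_integrable_omegaD)
    have "integrable (\<omega> (Suc n)) (\<lambda>x. cnj (f (r x)) * \<xi> x)"
      by (intro integrable_cnj_mult square_integrable_r f \<xi>)
    then have int: "integrable \<mu> (\<lambda>x. of_real (w (Suc n) x) * (cnj (f (r x)) * \<xi> x * complex_of_real (h x)))"
      by (subst (asm) integrable_omega) simp_all
    have eq: "fibre_avg r (\<lambda>x. of_real (w (Suc n) x) * (cnj (f (r x)) * \<xi> x * complex_of_real (h x)))
        = (\<lambda>x. cnj (f x) * a x)"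
    proof
      fix x
      \<comment> \<open>Both \<open>f (r y)\<close> and \<open>w n (r y)\<close> are constant on the
        fibre, which isolates one application of \<open>R\<close>.\<close>
      have "fibre_avg r (\<lambda>x. of_real (w (Suc n) x) * (cnj (f (r x)) * \<xi> x * complex_of_real (h x))) x
          = fibre_avg r (\<lambda>y. (cnj (f (r y)) * of_real (w n (r y)))
              * (of_real ((cmod (m0 y))\<^sup>2) * (\<xi> y * complex_of_real (h y)))) x"
        by (simp add: weight_Suc_shift mult_ac)
      also have "\<dots> = cnj (f x) * a x"
        by (subst fibre_avg_pull_out) (simp add: a_def transfer_op_eq_fibre_avg mult_ac)
      finally show "fibre_avg r (\<lambda>x. of_real (w (Suc n) x) * (cnj (f (r x)) * \<xi> x * complex_of_real (h x))) x
          = cnj (f x) * a x" .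
    qed
    show "integrable \<mu> (\<lambda>x. cnj (f x) * a x)"
      using fibre_avg_integral(1)[OF int] by (simp only: eq)
    show "(\<integral>x. cnj (f (r x)) * \<xi> x \<partial>\<omega> (Suc n)) = (\<integral>x. cnj (f x) * a x \<partial>\<mu>)"
      using fibre_avg_integral(2)[OF int] by (simp only: eq) (subst integral_omega, simp_all)
  qed
  have rhs: "integrable \<mu> (\<lambda>x. cnj (f x) * b x)"
    "(\<integral>x. cnj (f x) * \<eta> x \<partial>\<omega> n) = (\<integral>x. cnj (f x) * b x \<partial>\<mu>)"
    if f: "f \<in> square_integrable (\<omega> n)" for f
  proof -
    have [measurable]: "f \<in> borel_measurable borel" using f by (rule square_integrable_omegaD)
    show "(\<integral>x. cnj (f x) * \<eta> x \<partial>\<omega> n) = (\<integral>x. cnj (f x) * b x \<partial>\<mu>)"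
      by (subst integral_omega) (simp_all add: b_def mult_ac)
    have "integrable (\<omega> n) (\<lambda>x. cnj (f x) * \<eta> x)" by (intro integrable_cnj_mult f \<eta>)
    then show "integrable \<mu> (\<lambda>x. cnj (f x) * b x)"
      by (subst (asm) integrable_omega) (simp_all add: b_def mult_ac)
  qed
  have "?mart \<longleftrightarrow> (AE x in \<mu>. a x = b x)"
  proof
    assume ab: "AE x in \<mu>. a x = b x"
    show ?mart
    proof
      fix f assume f: "f \<in> square_integrable (\<omega> n)"
      then have [measurable]: "f \<in> borel_measurable borel" by (rule square_integrable_omegaD)
      have "AE x in \<mu>. cnj (f x) * a x = cnj (f x) * b x" using ab by eventually_elim simp
      then have "(\<integral>x. cnj (f x) * a x \<partial>\<mu>) = (\<integral>x. cnj (f x) * b x \<partial>\<mu>)"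
        by (rule integral_cong_AE[rotated 2]) simp_all
      then show "(\<integral>x. cnj (f (r x)) * \<xi> x \<partial>\<omega> (Suc n)) = (\<integral>x. cnj (f x) * \<eta> x \<partial>\<omega> n)"
        using lhs(2)[OF f] rhs(2)[OF f] by simp
    qed
  next
    assume mart: ?mart
    \<comment> \<open>The test function 1 shows that \<open>a\<close> and \<open>b\<close> are
      integrable; indicators then show that they have equal integrals over every Borel set.\<close>
    show "AE x in \<mu>. a x = b x"
    proof (rule density_unique_banach)
      show "integrable \<mu> a" "integrable \<mu> b"
        using lhs(1)[OF one_square_integrable(1)] rhs(1)[OF one_square_integrable(1)] by simp_all
      fix A assume "A \<in> sets \<mu>"
      then have "(\<lambda>x. indicator A x * 1) \<in> square_integrable (\<omega> n)"
        by (intro square_integrable_mult_bounded[where C=1] one_square_integrable)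
          (auto split: split_indicator)
      then have i: "indicator A \<in> square_integrable (\<omega> n)" by simp
      have "(\<integral>x. cnj (indicator A x) * a x \<partial>\<mu>) = (\<integral>x. cnj (indicator A x) * b x \<partial>\<mu>)"
        by (rule trans[OF lhs(2)[OF i, symmetric] trans[OF bspec[OF mart i] rhs(2)[OF i]]])
      moreover have "cnj (indicator A x) * c = indicat_real A x *\<^sub>R c" for x c
        by (simp split: split_indicator)
      ultimately show "set_lebesgue_integral \<mu> A a = set_lebesgue_integral \<mu> A b"
        by (simp add: set_lebesgue_integral_def)
    qed
  qed
  with ae show ?thesis by simp
qed

lemma vinner_omega:
  assumes "\<Xi> \<in> vcarrier (L2 (\<omega> n))" "\<Psi> \<in> vcarrier (L2 (\<omega> n))"
  shows "(\<integral>x. (transfer_op r m0 ^^ n) (\<lambda>y. cnj (rep \<Xi> y) * rep \<Psi> y * complex_of_real (h y)) x \<partial>\<mu>)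
    = vinner (L2 (\<omega> n)) \<Xi> \<Psi>"
  unfolding L2_vinner_rep
  by (intro integral_transfer_op_pow integrable_cnj_mult L2_rep assms)

lemma norm_omega:
  assumes "\<Xi> \<in> vcarrier (L2 (\<omega> n))"
  shows "(\<integral>x. (transfer_op r m0 ^^ n) (\<lambda>y. (cmod (rep \<Xi> y))\<^sup>2 * h y) x \<partial>\<mu>)
    = Re (vinner (L2 (\<omega> n)) \<Xi> \<Xi>)"
proof -
  have sq: "rep \<Xi> \<in> square_integrable (\<omega> n)" by (rule L2_rep[OF assms])
  then have [measurable]: "rep \<Xi> \<in> borel_measurable borel" by (rule square_integrable_omegaD)
  have int: "integrable \<mu> (\<lambda>y. w n y * ((cmod (rep \<Xi> y))\<^sup>2 * h y))"
    using sq weight_h_nonneg[of n] unfolding square_integrable_def omega_eq_density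
    by (simp add: integrable_density mult_ac)
  have "(\<integral>x. (transfer_op r m0 ^^ n) (\<lambda>y. (cmod (rep \<Xi> y))\<^sup>2 * h y) x \<partial>\<mu>)
      = (\<integral>y. w n y * ((cmod (rep \<Xi> y))\<^sup>2 * h y) \<partial>\<mu>)"
    using int by (simp add: transfer_op_pow fibre_avg_pow_integral_real)
  also have "\<dots> = (\<integral>y. (cmod (rep \<Xi> y))\<^sup>2 \<partial>\<omega> n)"
    unfolding omega_eq_density using weight_h_nonneg[of n]
    by (subst integral_density) (simp_all add: mult_ac)
  also have "\<dots> = Re (vinner (L2 (\<omega> n)) \<Xi> \<Xi>)"
    using L2_vinner_self[OF sq] by (simp add: L2_rep assms)
  finally show ?thesis .
qed

text \<open>The defining conditions correspond one by one: iterates of \<open>R\<close> compute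
  norms in \<open>\<omega> n\<close>, and the identity for \<open>R\<close> is the martingale
  property.\<close>

lemma carrier_seq_space: "vcarrier (seq_space r \<mu> m0 h) = T.bounded_martingales"
proof -
  have mart: "(AE x in \<omega> n. transfer_op r m0 (\<lambda>y. rep (\<Xi> (Suc n)) y * complex_of_real (h y)) x
        = rep (\<Xi> n) x * complex_of_real (h x))
      \<longleftrightarrow> (\<forall>x\<in>vcarrier (L2 (\<omega> n)).
        vinner (L2 M) (i_map M n x) (i_map M (Suc n) (\<Xi> (Suc n))) = vinner (L2 (\<omega> n)) x (\<Xi> n))"
    if \<Xi>: "\<And>n. \<Xi> n \<in> vcarrier (L2 (\<omega> n))" for \<Xi> n
  proof -
    note sq = L2_rep(1)[OF \<Xi>]
    have inner: "vinner (L2 M) (i_map M n (ae_class (\<omega> n) f)) (i_map M (Suc n) (\<Xi> (Suc n)))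
        = (\<integral>x. cnj (f (r x)) * rep (\<Xi> (Suc n)) x \<partial>\<omega> (Suc n))"
      "vinner (L2 (\<omega> n)) (ae_class (\<omega> n) f) (\<Xi> n) = (\<integral>x. cnj (f x) * rep (\<Xi> n) x \<partial>\<omega> n)"
      if f: "f \<in> square_integrable (\<omega> n)" for f
    proof -
      have [measurable]: "f \<in> borel_measurable borel" "rep (\<Xi> (Suc n)) \<in> borel_measurable borel"
        using f sq by (auto dest: square_integrable_omegaD)
      show "vinner (L2 (\<omega> n)) (ae_class (\<omega> n) f) (\<Xi> n) = (\<integral>x. cnj (f x) * rep (\<Xi> n) x \<partial>\<omega> n)"
        using L2_vinner[OF f sq[of n]] by (simp add: L2_rep \<Xi>)
      have "vinner (L2 M) (i_map M n (ae_class (\<omega> n) f)) (i_map M (Suc n) (ae_class (\<omega> (Suc n)) (rep (\<Xi> (Suc n)))))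
        = (\<integral>z. cnj (f (theta n z)) * rep (\<Xi> (Suc n)) (theta (Suc n) z) \<partial>M)"
        by (simp add: i_map_ae_class L2_vinner square_integrable_theta f sq)
      \<comment> \<open>Writing \<open>theta n\<close> as \<open>r\<close> after
        \<open>theta (Suc n)\<close> leaves a function of a single coordinate, whose distribution is
        known.\<close>
      also have "\<dots> = (\<integral>z. cnj (f (r (theta (Suc n) z))) * rep (\<Xi> (Suc n)) (theta (Suc n) z) \<partial>M)"
        by (intro Bochner_Integration.integral_cong) (simp_all add: theta_Suc)
      also have "\<dots> = (\<integral>x. cnj (f (r x)) * rep (\<Xi> (Suc n)) x \<partial>\<omega> (Suc n))"
        by (rule integral_theta) simp
      finally show "vinner (L2 M) (i_map M n (ae_class (\<omega> n) f)) (i_map M (Suc n) (\<Xi> (Suc n)))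
        = (\<integral>x. cnj (f (r x)) * rep (\<Xi> (Suc n)) x \<partial>\<omega> (Suc n))"
        by (simp add: L2_rep \<Xi>)
    qed
    show ?thesis
      unfolding transfer_op_eq_iff_martingale[OF sq sq] L2_carrier_eq
      by (simp add: inner cong: ball_cong)
  qed
  show ?thesis
    unfolding seq_space_def T.bounded_martingales_def
    by (auto simp: mart norm_omega)
qed

lemma hilbert_space_isomorphism_Phi:
  "hilbert_space_isomorphism (L2 M) (seq_space r \<mu> m0 h) (Phi \<omega> M)"
  unfolding components_eq_Phi[symmetric]
proof (rule T.hilbert_space_isomorphism_components)
  show "vcarrier (seq_space r \<mu> m0 h) = T.bounded_martingales" by (rule carrier_seq_space)
next
  fix \<Xi> \<Psi> assume "\<Xi> \<in> vcarrier (seq_space r \<mu> m0 h)" "\<Psi> \<in> vcarrier (seq_space r \<mu> m0 h)"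
  then have "\<Xi> n \<in> vcarrier (L2 (\<omega> n))" "\<Psi> n \<in> vcarrier (L2 (\<omega> n))" for n
    by (auto simp: seq_space_def)
  then show "vinner (seq_space r \<mu> m0 h) \<Xi> \<Psi> = lim (\<lambda>n. vinner (L2 (\<omega> n)) (\<Xi> n) (\<Psi> n))"
    by (simp add: seq_space_def vinner_omega)
qed (simp_all add: seq_space_def)

lemma bij_Phi: "bij_betw (Phi \<omega> M) (vcarrier (L2 M)) (vcarrier (seq_space r \<mu> m0 h))"
  using T.bij_components by (simp add: components_eq_Phi carrier_seq_space)

text \<open>\<open>lim\<close> yields some value even for a divergent sequence; this shows that the
  scalar product of the target is a genuine limit.\<close>

lemma convergent_inner:
  assumes "\<Xi> \<in> vcarrier (seq_space r \<mu> m0 h)" "\<Psi> \<in> vcarrier (seq_space r \<mu> m0 h)"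
  shows "convergent (\<lambda>n. \<integral>x. (transfer_op r m0 ^^ n)
      (\<lambda>y. cnj (rep (\<Xi> n) y) * rep (\<Psi> n) y * complex_of_real (h y)) x \<partial>\<mu>)"
proof -
  obtain u v where "u \<in> vcarrier (L2 M)" "\<Xi> = T.components u" "v \<in> vcarrier (L2 M)" "\<Psi> = T.components v"
    using assms T.bij_components unfolding carrier_seq_space bij_betw_def by blast
  then have "convergent (\<lambda>n. vinner (L2 (\<omega> n)) (\<Xi> n) (\<Psi> n))"
    using T.components_inner_tendsto[of u v] convergentI by blast
  moreover have "\<Xi> n \<in> vcarrier (L2 (\<omega> n))" "\<Psi> n \<in> vcarrier (L2 (\<omega> n))" for n
    using assms by (auto simp: seq_space_def)
  ultimately show ?thesis by (simp add: vinner_omega)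
qed

section \<open>The operators and the vector \<open>\<phi>\<close> under \<open>Phi\<close>\<close>

lemma Phi_eqI:
  assumes f: "f \<in> square_integrable M" and \<psi>: "\<And>n. \<psi> n \<in> square_integrable (\<omega> n)"
    and eq: "\<And>n x. x \<in> square_integrable (\<omega> n) \<Longrightarrow>
      (\<integral>u. cnj (x u) * \<psi> n u \<partial>\<omega> n) = (\<integral>z. cnj (x (theta n z)) * f z \<partial>M)"
  shows "Phi \<omega> M (ae_class M f) = (\<lambda>n. ae_class (\<omega> n) (\<psi> n))"
  unfolding components_eq_Phi[symmetric] T.components_def
proof (intro ext T.I.adj_unique)
  fix n x assume "x \<in> vcarrier (L2 (\<omega> n))"
  then show "vinner (L2 (\<omega> n)) x (ae_class (\<omega> n) (\<psi> n)) = vinner (L2 M) (i_map M n x) (ae_class M f)"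
    by (elim L2_carrierE)
      (simp add: i_map_ae_class L2_vinner square_integrable_theta f \<psi> eq)
qed (auto intro: L2_carrierI f \<psi>)

lemma Phi_inner:
  assumes f: "F \<in> vcarrier (L2 M)" and x: "x \<in> square_integrable (\<omega> n)"
  shows "(\<integral>u. cnj (x u) * rep (Phi \<omega> M F n) u \<partial>\<omega> n) = (\<integral>z. cnj (x (theta n z)) * rep F z \<partial>M)"
proof -
  have c: "Phi \<omega> M F n \<in> vcarrier (L2 (\<omega> n))"
    unfolding components_eq_Phi[symmetric] T.components_def by (rule T.I.adj_closed[OF f])
  have "vinner (L2 (\<omega> n)) (ae_class (\<omega> n) x) (Phi \<omega> M F n)
      = vinner (L2 M) (i_map M n (ae_class (\<omega> n) x)) F"
    unfolding components_eq_Phi[symmetric] T.components_def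
    by (rule T.I.inner_adj[OF f L2_carrierI[OF x]])
  then show ?thesis
    using L2_vinner[OF x L2_rep(1)[OF c]] L2_vinner[OF square_integrable_theta[OF x] L2_rep(1)[OF f]]
    by (simp add: i_map_ae_class x L2_rep c f)
qed

lemma Phi_one: "Phi \<omega> M (ae_class M (\<lambda>x. 1)) = (\<lambda>n. ae_class (\<omega> n) (\<lambda>x. 1))"
proof (rule Phi_eqI)
  fix n x assume "x \<in> square_integrable (\<omega> n)"
  then have [measurable]: "x \<in> borel_measurable borel" by (rule square_integrable_omegaD)
  show "(\<integral>u. cnj (x u) * 1 \<partial>\<omega> n) = (\<integral>z. cnj (x (theta n z)) * 1 \<partial>M)"
    using integral_theta[of "\<lambda>u. cnj (x u)" n] by simp
qed (rule one_square_integrable)+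

lemma Phi_pi_op:
  assumes g: "g \<in> Linf \<mu>" and F: "F \<in> vcarrier (L2 M)"
  shows "Phi \<omega> M (pi_op M g F) = (\<lambda>n. ae_class (\<omega> n) (\<lambda>x. g ((r ^^ n) x) * rep (Phi \<omega> M F n) x))"
  unfolding pi_op_def
proof (rule Phi_eqI)
  have [measurable]: "g \<in> borel_measurable borel" using g by (auto simp: Linf_def)
  obtain C where C: "AE x in \<mu>. cmod (g x) \<le> C" using g by (auto simp: Linf_def)
  \<comment> \<open>Invariance of \<open>\<mu>\<close> moves the bound along r^n, and
    \<open>\<omega> n\<close> is absolutely continuous with respect to \<open>\<mu>\<close>.\<close>
  have C_omega: "AE x in \<omega> n. cmod (g ((r ^^ n) x)) \<le> C" for n
    using AE_r_pow[OF C, of n] unfolding AE_omega by eventually_elim simp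
  have c: "rep (Phi \<omega> M F n) \<in> square_integrable (\<omega> n)" for n
    unfolding components_eq_Phi[symmetric] T.components_def
    by (rule L2_rep(1)) (rule T.I.adj_closed[OF F])
  have "AE z in M. cmod (g (theta 0 z)) \<le> C"
    using AE_theta[OF C_omega[of 0]] by simp
  then show "(\<lambda>z. g (theta 0 z) * rep F z) \<in> square_integrable M"
    by (intro square_integrable_mult_bounded L2_rep F) auto
  show "(\<lambda>x. g ((r ^^ n) x) * rep (Phi \<omega> M F n) x) \<in> square_integrable (\<omega> n)" for n
    by (rule square_integrable_mult_bounded[OF c _ C_omega]) simp
  fix n x assume x: "x \<in> square_integrable (\<omega> n)"
  \<comment> \<open>The multiplier is moved onto the test function, where boundedness of
    \<open>g\<close> keeps it square integrable; on the solenoid r^n after \<open>theta n\<close> is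
    \<open>theta 0\<close>.\<close>
  let ?x = "\<lambda>u. cnj (g ((r ^^ n) u)) * x u"
  have "?x \<in> square_integrable (\<omega> n)"
    using C_omega[of n] by (intro square_integrable_mult_bounded[OF x, where C=C]) auto
  from Phi_inner[OF F this]
  have "(\<integral>u. cnj (x u) * (g ((r ^^ n) u) * rep (Phi \<omega> M F n) u) \<partial>\<omega> n)
      = (\<integral>z. cnj (?x (theta n z)) * rep F z \<partial>M)" by (simp add: mult_ac)
  also have "\<dots> = (\<integral>z. cnj (x (theta n z)) * (g (theta 0 z) * rep F z) \<partial>M)"
    by (intro Bochner_Integration.integral_cong) (simp_all add: theta_pow mult_ac)
  finally show "(\<integral>u. cnj (x u) * (g ((r ^^ n) u) * rep (Phi \<omega> M F n) u) \<partial>\<omega> n)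
      = (\<integral>z. cnj (x (theta n z)) * (g (theta 0 z) * rep F z) \<partial>M)" .
qed

lemma rhat_measurable [measurable]: "rhat r \<in> M \<rightarrow>\<^sub>M M"
proof (rule measurable_sigma_sets[OF sets_M_sigma cylinders_Pow])
  show "rhat r \<in> space M \<rightarrow> Xinf r" by (auto simp: space_M rhat_Xinf)
  fix a assume "a \<in> cylinders"
  then obtain n A where a: "a = theta n -` A \<inter> Xinf r" and [measurable]: "A \<in> sets borel"
    by (auto simp: cylinders_def)
  have "rhat r -` a \<inter> space M = {z \<in> space M. r (theta n z) \<in> A}"
    by (auto simp: a space_M rhat_Xinf theta_rhat)
  also have "\<dots> \<in> sets M" by measurable
  finally show "rhat r -` a \<inter> space M \<in> sets M" .
qed

text \<open>This is the isometry property of \<open>U\<close>.\<close>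

lemma distr_rhat: "distr (density M (\<lambda>z. (cmod (m0 (theta 0 z)))\<^sup>2)) M (rhat r) = M"
  (is "?N = M")
proof (rule sym, rule measure_eqI_generator_eq[OF Int_stable_cylinders cylinders_Pow])
  fix X assume "X \<in> cylinders"
  then obtain n A where X: "X = theta n -` A \<inter> Xinf r" and [measurable]: "A \<in> sets borel"
    by (auto simp: cylinders_def)
  define B where "B = r -` A"
  have B[measurable]: "B \<in> sets borel"
    unfolding B_def using measurable_sets[OF r_measurable, of A] by simp
  \<comment> \<open>The cylinder is raised one level so that \<open>rhat\<close> can lower it again:
    \<open>theta (Suc n)\<close> after \<open>rhat r\<close> is \<open>theta n\<close>.\<close>
  have XB: "X = theta (Suc n) -` B \<inter> space M"
    using theta_Suc by (auto simp: X B_def space_M)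
  have X_sets: "X \<in> sets M" unfolding XB by measurable
  have rX: "rhat r -` X \<inter> space M = theta n -` B \<inter> space M"
    using rhat_Xinf[of _ r] by (auto simp: XB space_M)
  have "emeasure ?N X = (\<integral>\<^sup>+z. ennreal ((cmod (m0 (theta 0 z)))\<^sup>2) * indicator (theta n -` B \<inter> space M) z \<partial>M)"
    using X_sets by (simp add: emeasure_distr rX emeasure_density)
  also have "\<dots> = (\<integral>\<^sup>+z. ennreal ((cmod (m0 ((r ^^ n) (theta n z))))\<^sup>2) * indicator B (theta n z) \<partial>M)"
    by (intro nn_integral_cong) (auto simp: theta_pow split: split_indicator)
  also have "\<dots> = (\<integral>\<^sup>+x. ennreal ((cmod (m0 ((r ^^ n) x)))\<^sup>2) * indicator B x \<partial>\<omega> n)"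
    unfolding distr_theta[symmetric] by (subst nn_integral_distr) simp_all
  also have "\<dots> = emeasure (\<omega> (Suc n)) B"
    unfolding omega_Suc by (subst emeasure_density) simp_all
  also have "\<dots> = emeasure M X"
    unfolding distr_theta[symmetric] XB by (rule emeasure_distr) simp_all
  finally show "emeasure M X = emeasure ?N X" by simp
next
  \<comment> \<open>The finite total mass allows the constant sequence as the exhaustion required by
    uniqueness of measures.\<close>
  have "Xinf r \<in> cylinders"
    unfolding cylinders_def by (intro CollectI exI[of _ 0] exI[of _ UNIV]) simp
  then show "range (\<lambda>_::nat. Xinf r) \<subseteq> cylinders" by auto
qed (auto simp: sets_M_sigma)

lemma integral_rhat:
  fixes f :: "(nat \<Rightarrow> 'a) \<Rightarrow> complex"
  assumes [measurable]: "f \<in> borel_measurable M"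
  shows "(\<integral>z. f z \<partial>M) = (\<integral>z. (cmod (m0 (theta 0 z)))\<^sup>2 *\<^sub>R f (rhat r z) \<partial>M)"
proof -
  let ?D = "density M (\<lambda>z. (cmod (m0 (theta 0 z)))\<^sup>2)"
  have "(\<integral>z. f z \<partial>M) = (\<integral>z. f z \<partial>distr ?D M (rhat r))" by (simp only: distr_rhat)
  also have "\<dots> = (\<integral>z. f (rhat r z) \<partial>?D)" by (rule integral_distr) simp_all
  also have "\<dots> = (\<integral>z. (cmod (m0 (theta 0 z)))\<^sup>2 *\<^sub>R f (rhat r z) \<partial>M)"
    by (rule integral_density) simp_all
  finally show ?thesis .
qed

lemma square_integrable_rhat:
  assumes f: "f \<in> square_integrable M"
  shows "(\<lambda>z. m0 (theta 0 z) * f (rhat r z)) \<in> square_integrable M"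
proof -
  let ?D = "density M (\<lambda>z. (cmod (m0 (theta 0 z)))\<^sup>2)"
  have [measurable]: "f \<in> borel_measurable M" using f by (simp add: square_integrable_def)
  have "integrable (distr ?D M (rhat r)) (\<lambda>z. (cmod (f z))\<^sup>2)"
    unfolding distr_rhat using f by (simp add: square_integrable_def)
  then have "integrable ?D (\<lambda>z. (cmod (f (rhat r z)))\<^sup>2)"
    by (subst (asm) integrable_distr_eq) simp_all
  then have "integrable M (\<lambda>z. (cmod (m0 (theta 0 z)))\<^sup>2 *\<^sub>R (cmod (f (rhat r z)))\<^sup>2)"
    by (subst (asm) integrable_density) simp_all
  then show ?thesis by (simp add: square_integrable_def norm_mult power_mult_distrib)
qed

text \<open>The test function \<open>x\<close> at level \<open>n\<close> is replaced by \<open>x / m\<^sub>0 \<circ> r\<^sup>n\<close> at level \<open>n + 1\<close>, which undoes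
  the multiplication by \<open>m\<^sub>0\<close>. Division by zero is harmless, as \<open>\<omega>\<^bsub>n+1\<^esub>\<close> does not charge the zeros
  of \<open>m\<^sub>0 \<circ> r\<^sup>n\<close>.\<close>

lemma Phi_U_op:
  assumes F: "F \<in> vcarrier (L2 M)"
  shows "Phi \<omega> M (U_op r m0 M F) = (\<lambda>n. ae_class (\<omega> n) (\<lambda>x. m0 ((r ^^ n) x) * rep (Phi \<omega> M F (Suc n)) x))"
  unfolding U_op_def
proof (rule Phi_eqI)
  show "(\<lambda>z. m0 (theta 0 z) * rep F (rhat r z)) \<in> square_integrable M"
    by (intro square_integrable_rhat L2_rep F)
  have [measurable]: "rep F \<in> borel_measurable M"
    using L2_rep(1)[OF F] by (simp add: square_integrable_def)
  have c: "rep (Phi \<omega> M F n) \<in> square_integrable (\<omega> n)" for n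
    unfolding components_eq_Phi[symmetric] T.components_def
    by (rule L2_rep(1)) (rule T.I.adj_closed[OF F])
  have [measurable]: "rep (Phi \<omega> M F n) \<in> borel_measurable borel" for n
    using c by (rule square_integrable_omegaD)
  show "(\<lambda>x. m0 ((r ^^ n) x) * rep (Phi \<omega> M F (Suc n)) x) \<in> square_integrable (\<omega> n)" for n
  proof -
    \<comment> \<open>The factor |m0 o r^n|^2 is the density of \<open>\<omega> (Suc n)\<close> over
      \<open>\<omega> n\<close>, so the claim is square integrability one level up.\<close>
    have "integrable (\<omega> (Suc n)) (\<lambda>x. (cmod (rep (Phi \<omega> M F (Suc n)) x))\<^sup>2)"
      using c[of "Suc n"] by (simp add: square_integrable_def)
    then have "integrable (\<omega> n) (\<lambda>x. (cmod (m0 ((r ^^ n) x)))\<^sup>2 *\<^sub>R (cmod (rep (Phi \<omega> M F (Suc n)) x))\<^sup>2)"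
      unfolding omega_Suc by (subst (asm) integrable_density) simp_all
    then show ?thesis by (simp add: square_integrable_def norm_mult power_mult_distrib)
  qed
  fix n x assume x: "x \<in> square_integrable (\<omega> n)"
  then have [measurable]: "x \<in> borel_measurable borel" by (rule square_integrable_omegaD)
  define y where "y u = x u / m0 ((r ^^ n) u)" for u
  have y_meas[measurable]: "y \<in> borel_measurable borel" unfolding y_def by measurable
  have y: "y \<in> square_integrable (\<omega> (Suc n))"
  proof -
    have "integrable (\<omega> n) (\<lambda>u. (cmod (m0 ((r ^^ n) u)))\<^sup>2 *\<^sub>R (cmod (y u))\<^sup>2)"
    proof (rule Bochner_Integration.integrable_bound)
      show "integrable (\<omega> n) (\<lambda>u. (cmod (x u))\<^sup>2)" using x by (simp add: square_integrable_def)
      show "AE u in \<omega> n. norm ((cmod (m0 ((r ^^ n) u)))\<^sup>2 *\<^sub>R (cmod (y u))\<^sup>2) \<le> norm ((cmod (x u))\<^sup>2)"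
        by (auto simp: y_def norm_divide power_divide)
    qed simp
    then have "integrable (\<omega> (Suc n)) (\<lambda>u. (cmod (y u))\<^sup>2)"
      unfolding omega_Suc by (subst integrable_density) simp_all
    then show ?thesis by (simp add: square_integrable_def)
  qed
  \<comment> \<open>For \<open>a = 0\<close> both sides vanish, since division by zero yields
    0.\<close>
  have cancel: "(cmod a)\<^sup>2 *\<^sub>R (cnj (b / a) * c) = cnj b * (a * c)" for a b c :: complex
    by (cases "a = 0") (simp_all add: scaleR_conv_of_real complex_norm_square field_simps del: of_real_power)
  have "(\<integral>u. cnj (x u) * (m0 ((r ^^ n) u) * rep (Phi \<omega> M F (Suc n)) u) \<partial>\<omega> n)
      = (\<integral>u. (cmod (m0 ((r ^^ n) u)))\<^sup>2 *\<^sub>R (cnj (y u) * rep (Phi \<omega> M F (Suc n)) u) \<partial>\<omega> n)"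
    unfolding y_def cancel ..
  also have "\<dots> = (\<integral>u. cnj (y u) * rep (Phi \<omega> M F (Suc n)) u \<partial>\<omega> (Suc n))"
    unfolding omega_Suc by (subst integral_density) simp_all
  also have "\<dots> = (\<integral>z. cnj (y (theta (Suc n) z)) * rep F z \<partial>M)"
    by (rule Phi_inner[OF F y])
  \<comment> \<open>The substitution by \<open>rhat\<close> brings the test function from level
    \<open>Suc n\<close> back to level \<open>n\<close> and supplies the density that cancels the
    division.\<close>
  also have "\<dots> = (\<integral>z. (cmod (m0 (theta 0 z)))\<^sup>2 *\<^sub>R (cnj (y (theta n z)) * rep F (rhat r z)) \<partial>M)"
    by (subst integral_rhat) simp_all
  also have "\<dots> = (\<integral>z. cnj (x (theta n z)) * (m0 (theta 0 z) * rep F (rhat r z)) \<partial>M)"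
    by (intro Bochner_Integration.integral_cong refl) (simp only: y_def theta_pow cancel)
  finally show "(\<integral>u. cnj (x u) * (m0 ((r ^^ n) u) * rep (Phi \<omega> M F (Suc n)) u) \<partial>\<omega> n)
      = (\<integral>z. cnj (x (theta n z)) * (m0 (theta 0 z) * rep F (rhat r z)) \<partial>M)" .
qed

end

theorem theorem6p1:
  fixes r :: "'a::metric_space \<Rightarrow> 'a"
    and \<mu> :: "'a measure"
    and m0 :: "'a \<Rightarrow> complex"
    and h :: "'a \<Rightarrow> real"
    and \<mu>hat :: "(nat \<Rightarrow> 'a) measure"
  assumes "compact (UNIV :: 'a set)"
    and "r \<in> borel \<rightarrow>\<^sub>M borel" and "surj r" and "\<And>x. finite (r -` {x})"
    and "sets \<mu> = sets borel" and "prob_space \<mu>" and "strongly_invariant r \<mu>"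
    and "m0 \<in> Linf \<mu>"
    and "integrable \<mu> h" and "AE x in \<mu>. 0 \<le> h x" and "AE x in \<mu>. transfer_op r m0 h x = h x"
    and "sets \<mu>hat = sets (Xinf_space r)"
    and "\<And>n. distr \<mu>hat borel (theta n) = omega r \<mu> m0 h n"
  shows "(\<forall>\<Xi>\<in>vcarrier (seq_space r \<mu> m0 h). \<forall>\<Psi>\<in>vcarrier (seq_space r \<mu> m0 h).
            convergent (\<lambda>n. \<integral>x. (transfer_op r m0 ^^ n)
              (\<lambda>y. cnj (rep (\<Xi> n) y) * rep (\<Psi> n) y * complex_of_real (h y)) x \<partial>\<mu>))
       \<and> hilbert_space_isomorphism (L2 \<mu>hat) (seq_space r \<mu> m0 h) (Phi (omega r \<mu> m0 h) \<mu>hat)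
       \<and> (\<forall>\<Xi>\<in>vcarrier (seq_space r \<mu> m0 h).
            Phi (omega r \<mu> m0 h) \<mu>hat (U_op r m0 \<mu>hat
                (inv_into (vcarrier (L2 \<mu>hat)) (Phi (omega r \<mu> m0 h) \<mu>hat) \<Xi>))
              = (\<lambda>n. ae_class (omega r \<mu> m0 h n) (\<lambda>x. m0 ((r ^^ n) x) * rep (\<Xi> (Suc n)) x)))
       \<and> (\<forall>g\<in>Linf \<mu>. \<forall>\<Xi>\<in>vcarrier (seq_space r \<mu> m0 h).
            Phi (omega r \<mu> m0 h) \<mu>hat (pi_op \<mu>hat g
                (inv_into (vcarrier (L2 \<mu>hat)) (Phi (omega r \<mu> m0 h) \<mu>hat) \<Xi>))
              = (\<lambda>n. ae_class (omega r \<mu> m0 h n) (\<lambda>x. g ((r ^^ n) x) * rep (\<Xi> n) x)))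
       \<and> Phi (omega r \<mu> m0 h) \<mu>hat (ae_class \<mu>hat (\<lambda>x. 1))
              = (\<lambda>n. ae_class (omega r \<mu> m0 h n) (\<lambda>x. 1))"
proof -
  interpret solenoid_system \<mu> r m0 h \<mu>hat
    using assms
    by (auto simp: solenoid_system_def weighted_system_def invariant_system_def
        solenoid_system_axioms_def weighted_system_axioms_def invariant_system_axioms_def)
  \<comment> \<open>Every \<open>\<Xi>\<close> is the image under \<open>Phi\<close> of the class
    chosen by \<open>inv_into\<close>, so formulas for \<open>Phi\<close> of an operator applied to
    \<open>F\<close> become formulas in \<open>\<Xi>\<close>.\<close>
  have inv: "inv_into (vcarrier (L2 \<mu>hat)) (Phi \<omega> \<mu>hat) \<Xi> \<in> vcarrier (L2 \<mu>hat)"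
    "Phi \<omega> \<mu>hat (inv_into (vcarrier (L2 \<mu>hat)) (Phi \<omega> \<mu>hat) \<Xi>) = \<Xi>"
    if "\<Xi> \<in> vcarrier (seq_space r \<mu> m0 h)" for \<Xi>
    using bij_Phi that by (auto simp: bij_betw_def inv_into_into f_inv_into_f)
  show ?thesis
    using convergent_inner hilbert_space_isomorphism_Phi Phi_one
    by (simp add: Phi_U_op Phi_pi_op inv)
qed

end
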